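(* Let $(X,d)$ be a non-elementary $\delta$-hyperbolic space and $\Gamma$ a group acting properly by isometries on $X$ with $\operatorname{diam}(\Gamma\backslash X)\le D$. Put $M_0=\max\big(20(\frac{D}{\delta}+2),\,720\big)$. Then at least one of the following holds: (a) $\operatorname{Ent}(X,d)>\frac{1}{750\,\delta}$; (b) $\ell(\gamma)>3^{-34}\,\delta\,M_0\,e^{-\frac{4}{29}M_0}$ for every element $\gamma\in\Gamma^*$ which is not of finite order.
   Context: A $\delta$-hyperbolic space is a geodesic proper metric space all of whose geodesic triangles are $\delta$-thin (tripod definition: for a triangle with vertices $x,y,z$, the tripod with edge lengths the Gromov products $(y|z)_x=\frac12(d(x,y)+d(x,z)-d(y,z))$ etc., and the map to it isometric on sides and sending vertices to ends; points with the same image are at distance $\le\delta$). Non-elementary: Gromov boundary has at least three points. Proper action: $\{\gamma:d(x,\gamma x)\le R\}$ finite. $\Gamma^*=\Gamma\setminus\{e\}$; $\bar d(\Gamma x,\Gamma y)=\inf_\gamma d(x,\gamma y)$ is the quotient distance. $\ell(\gamma)=\lim_k\frac1kd(x,\gamma^kx)$. $\operatorname{Ent}(X,d)=\liminf_{R\to\infty}\frac1R\ln\#\{\gamma\in\Gamma:d(x,\gamma x)<R\}$. *)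

theory Defs
  imports "HOL-Analysis.Analysis" "HOL-Algebra.Group"
begin

definition gromov_prod :: "'a::metric_space \<Rightarrow> 'a \<Rightarrow> 'a \<Rightarrow> real" where
  "gromov_prod x y z = (dist z x + dist z y - dist x y) / 2"

definition geodesic_seg :: "(real \<Rightarrow> 'a::metric_space) \<Rightarrow> 'a \<Rightarrow> 'a \<Rightarrow> bool" where
  "geodesic_seg c x y \<longleftrightarrow> c 0 = x \<and> c (dist x y) = y \<and>
     (\<forall>s\<in>{0..dist x y}. \<forall>t\<in>{0..dist x y}. dist (c s) (c t) = \<bar>s - t\<bar>)"

definition geodesic_space :: "'a::metric_space itself \<Rightarrow> bool" where
  "geodesic_space _ \<longleftrightarrow> (\<forall>x y::'a. \<exists>c. geodesic_seg c x y)"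

definition proper_space :: "'a::metric_space itself \<Rightarrow> bool" where
  "proper_space _ \<longleftrightarrow> (\<forall>(x::'a) r. compact (cball x r))"

text \<open>Tripod thinness of the geodesic triangle with sides p : x\<rightarrow>y, q : y\<rightarrow>z, r : z\<rightarrow>x:
  points of two sides issuing from a common vertex at the same distance t from it,
  t at most the Gromov product at that vertex, have the same image in the tripod.\<close>
definition thin_triangle ::
  "real \<Rightarrow> 'a::metric_space \<Rightarrow> 'a \<Rightarrow> 'a \<Rightarrow> (real \<Rightarrow> 'a) \<Rightarrow> (real \<Rightarrow> 'a) \<Rightarrow> (real \<Rightarrow> 'a) \<Rightarrow> bool" where
  "thin_triangle \<delta> x y z p q r \<longleftrightarrow>
     (\<forall>t\<in>{0..gromov_prod y z x}. dist (p t) (r (dist z x - t)) \<le> \<delta>) \<and>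
     (\<forall>t\<in>{0..gromov_prod z x y}. dist (q t) (p (dist x y - t)) \<le> \<delta>) \<and>
     (\<forall>t\<in>{0..gromov_prod x y z}. dist (r t) (q (dist y z - t)) \<le> \<delta>)"

definition hyperbolic_space :: "real \<Rightarrow> 'a::metric_space itself \<Rightarrow> bool" where
  "hyperbolic_space \<delta> T \<longleftrightarrow> geodesic_space T \<and> proper_space T \<and>
     (\<forall>(x::'a) y z p q r. geodesic_seg p x y \<and> geodesic_seg q y z \<and> geodesic_seg r z x
        \<longrightarrow> thin_triangle \<delta> x y z p q r)"

definition conv_at_infinity :: "'a::metric_space \<Rightarrow> (nat \<Rightarrow> 'a) \<Rightarrow> bool" where
  "conv_at_infinity b u \<longleftrightarrow> (\<forall>K. \<exists>N. \<forall>m\<ge>N. \<forall>n\<ge>N. gromov_prod (u m) (u n) b \<ge> K)"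

definition bdry_equiv :: "'a::metric_space \<Rightarrow> (nat \<Rightarrow> 'a) \<Rightarrow> (nat \<Rightarrow> 'a) \<Rightarrow> bool" where
  "bdry_equiv b u v \<longleftrightarrow> (\<forall>K. \<exists>N. \<forall>m\<ge>N. \<forall>n\<ge>N. gromov_prod (u m) (v n) b \<ge> K)"

text \<open>Non-elementary: the Gromov boundary has at least three points.\<close>
definition non_elementary :: "'a::metric_space itself \<Rightarrow> bool" where
  "non_elementary _ \<longleftrightarrow> (\<exists>(b::'a) u v w. conv_at_infinity b u \<and> conv_at_infinity b v \<and>
      conv_at_infinity b w \<and> \<not> bdry_equiv b u v \<and> \<not> bdry_equiv b v w \<and> \<not> bdry_equiv b u w)"

definition isometric_action :: "('g, 'b) monoid_scheme \<Rightarrow> ('g \<Rightarrow> 'a::metric_space \<Rightarrow> 'a) \<Rightarrow> bool" where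
  "isometric_action G act \<longleftrightarrow> group G \<and>
     (\<forall>x. act \<one>\<^bsub>G\<^esub> x = x) \<and>
     (\<forall>g\<in>carrier G. \<forall>h\<in>carrier G. \<forall>x. act (g \<otimes>\<^bsub>G\<^esub> h) x = act g (act h x)) \<and>
     (\<forall>g\<in>carrier G. \<forall>x y. dist (act g x) (act g y) = dist x y)"

definition proper_action :: "('g, 'b) monoid_scheme \<Rightarrow> ('g \<Rightarrow> 'a::metric_space \<Rightarrow> 'a) \<Rightarrow> bool" where
  "proper_action G act \<longleftrightarrow> (\<forall>x R. finite {g \<in> carrier G. dist x (act g x) \<le> R})"

definition quot_dist :: "('g, 'b) monoid_scheme \<Rightarrow> ('g \<Rightarrow> 'a::metric_space \<Rightarrow> 'a) \<Rightarrow> 'a \<Rightarrow> 'a \<Rightarrow> real" where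
  "quot_dist G act x y = (INF g\<in>carrier G. dist x (act g y))"

definition quot_diam_le :: "('g, 'b) monoid_scheme \<Rightarrow> ('g \<Rightarrow> 'a::metric_space \<Rightarrow> 'a) \<Rightarrow> real \<Rightarrow> bool" where
  "quot_diam_le G act D \<longleftrightarrow> (\<forall>x y. quot_dist G act x y \<le> D)"

definition transl_len :: "('g, 'b) monoid_scheme \<Rightarrow> ('g \<Rightarrow> 'a::metric_space \<Rightarrow> 'a) \<Rightarrow> 'a \<Rightarrow> 'g \<Rightarrow> real" where
  "transl_len G act x \<gamma> = lim (\<lambda>k::nat. dist x (act (\<gamma> [^]\<^bsub>G\<^esub> k) x) / real k)"

definition entropy :: "('g, 'b) monoid_scheme \<Rightarrow> ('g \<Rightarrow> 'a::metric_space \<Rightarrow> 'a) \<Rightarrow> 'a \<Rightarrow> ereal" where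
  "entropy G act x = Liminf at_top
     (\<lambda>R::real. ereal (ln (real (card {g \<in> carrier G. dist x (act g x) < R})) / R))"

end

theory Submission
  imports Defs
begin

text \<open>
  Let \<open>l\<close> be the translation length of an element \<open>\<gamma>\<close> of infinite order. The element \<open>\<gamma>\<close> has a
  quasi-axis: a point \<open>y\<close> with \<open>k l \<le> d(y, \<gamma>\<^sup>k y) \<le> k l + 8\<delta>\<close> for all \<open>k\<close>, found by pigeonholing
  along a long geodesic from \<open>x\<close> to \<open>\<gamma>\<^sup>n x\<close> an element that commutes with \<open>\<gamma>\<close> and translates.
  Suppose the entropy is small. If a translate of the axis came within \<open>49\<delta>\<close> of the axis and then
  left it, two words \<open>g \<gamma>\<^sup>k\<close> of displacement at most \<open>180\<delta>\<close> would generate a free semigroup and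
  the entropy would exceed \<open>1/(750\<delta>)\<close>; hence translates are parallel or far apart. If \<open>l\<close> is
  tiny, take a translate \<open>g\<close> at distance \<open>O(D + \<delta>)\<close> from the axis and the \<open>\<delta>/l\<close> words \<open>g \<gamma>\<^sup>k\<close>
  of displacement \<open>O(D + \<delta>)\<close>: a coincidence between words would force \<open>\<gamma>\<^sup>m\<close>, with \<open>m \<noteq> 0\<close>, almost to
  preserve the translated axis, which is impossible. So these words generate a free
  semigroup, whose growth is again too large.
\<close>

section \<open>Hyperbolic spaces and isometric actions\<close>

lemma geodesic_seg_rev:
  assumes "geodesic_seg c x y"
  shows "geodesic_seg (\<lambda>t. c (dist x y - t)) y x"
  using assms unfolding geodesic_seg_def
  by (auto simp: dist_commute)

lemma geodesic_seg_dist: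
  assumes "geodesic_seg c x y" "0 \<le> s" "s \<le> t" "t \<le> dist x y"
  shows "dist (c s) (c t) = t - s"
proof -
  have "dist (c s) (c t) = \<bar>s - t\<bar>"
    using assms unfolding geodesic_seg_def by (meson atLeastAtMost_iff order_trans)
  then show ?thesis using assms by simp
qed

lemma geodesic_seg_ends: "geodesic_seg c x y \<Longrightarrow> c 0 = x" "geodesic_seg c x y \<Longrightarrow> c (dist x y) = y"
  by (simp_all add: geodesic_seg_def)

lemma geodesic_seg_dist_ends:
  assumes "geodesic_seg c x y" "0 \<le> t" "t \<le> dist x y"
  shows "dist x (c t) = t" "dist (c t) y = dist x y - t"
  using geodesic_seg_dist[OF assms(1), of 0 t] geodesic_seg_dist[OF assms(1), of t "dist x y"]
    assms geodesic_seg_ends[OF assms(1)] by simp_all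

lemma gromov_prod_commute: "gromov_prod x y z = gromov_prod y x z"
  by (simp add: gromov_prod_def dist_commute)

lemma gromov_prod_le: "gromov_prod x y z \<le> dist z x"
  using dist_triangle[of z y x] by (simp add: gromov_prod_def dist_commute)

lemma gromov_prod_nonneg: "0 \<le> gromov_prod x y z"
  using dist_triangle[of x y z] by (simp add: gromov_prod_def dist_commute)

lemma gromov_prod_add: "gromov_prod x y z + gromov_prod z y x = dist x z"
  by (simp add: gromov_prod_def dist_commute field_simps)

lemma gromov_prod_perturb_point: "gromov_prod x y z \<le> gromov_prod x' y z + dist x x'"
  using dist_triangle[of z x x'] dist_triangle[of x' y x]
  by (simp add: gromov_prod_def dist_commute field_simps)

lemma gromov_prod_perturb_base: "gromov_prod x y z \<le> gromov_prod x y z' + dist z z'"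
  using dist_triangle[of z x z'] dist_triangle[of z y z']
  by (simp add: gromov_prod_def dist_commute field_simps)

locale gromov_hyperbolic =
  fixes \<delta> :: real and T :: "'a::metric_space itself"
  assumes delta_pos: "\<delta> > 0" and hyperbolic: "hyperbolic_space \<delta> TYPE('a)"
begin

lemma geodesic_exists: "\<exists>c. geodesic_seg c x (y::'a)"
  using hyperbolic by (auto simp: hyperbolic_space_def geodesic_space_def)

lemma geodesic_pairs_close:
  assumes p: "geodesic_seg p w x" and r: "geodesic_seg r w (y::'a)"
    and t: "0 \<le> t" "t \<le> gromov_prod x y w"
  shows "dist (p t) (r t) \<le> \<delta>"
proof -
  obtain q where q: "geodesic_seg q x y" using geodesic_exists by blast
  have "thin_triangle \<delta> w x y p q (\<lambda>t. r (dist w y - t))"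
    using hyperbolic p q geodesic_seg_rev[OF r] unfolding hyperbolic_space_def by blast
  then show ?thesis using t by (auto simp: thin_triangle_def dist_commute)
qed

text \<open>Go out the distance \<open>t\<close>, the minimum, along geodesics from
  \<open>w\<close>: two uses of thinness put the points towards \<open>x\<close> and
  \<open>z\<close> within 2 \<delta> of each other, and the halving in the Gromov product leaves a
  loss of \<delta>.\<close>

lemma gromov_prod_min: "min (gromov_prod x y w) (gromov_prod y z w) - \<delta> \<le> gromov_prod x z (w::'a)"
proof -
  define t where "t = min (gromov_prod x y w) (gromov_prod y z w)"
  have t0: "0 \<le> t" by (simp add: t_def gromov_prod_nonneg)
  have tx: "t \<le> dist w x" using gromov_prod_le[of x y w] by (simp add: t_def)
  have tz: "t \<le> dist w z" using gromov_prod_le[of z y w]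
    by (simp add: t_def gromov_prod_commute[of y z])
  obtain p q r where p: "geodesic_seg p w x" and q: "geodesic_seg q w y" and r: "geodesic_seg r w z"
    using geodesic_exists by metis
  have 1: "dist (p t) (q t) \<le> \<delta>" by (rule geodesic_pairs_close[OF p q t0]) (simp add: t_def)
  have 2: "dist (q t) (r t) \<le> \<delta>" by (rule geodesic_pairs_close[OF q r t0]) (simp add: t_def)
  have 3: "dist x (p t) = dist w x - t"
    using geodesic_seg_dist_ends[OF p t0 tx] by (simp add: dist_commute)
  have 4: "dist (r t) z = dist w z - t"
    using geodesic_seg_dist_ends[OF r t0 tz] by simp
  have "dist x z \<le> dist x (p t) + (dist (p t) (q t) + dist (q t) (r t)) + dist (r t) z"
    using dist_triangle[of x z "p t"] dist_triangle[of "p t" z "r t"] dist_triangle[of "p t" "r t" "q t"]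
    by linarith
  then have "t - \<delta> \<le> gromov_prod x z w"
    using 1 2 3 4 by (simp add: gromov_prod_def field_simps)
  then show ?thesis by (simp add: t_def)
qed

text \<open>The form in which hyperbolicity is used throughout: if \<open>x\<close> and
  \<open>z\<close> part early as seen from \<open>w\<close>, then \<open>y\<close> parts early from
  one of them; knowing that \<open>y\<close> follows one of them decides which.\<close>

lemma gromov_prod_split:
  assumes "gromov_prod x z (w::'a) \<le> b"
  shows "gromov_prod x y w \<le> b + \<delta> \<or> gromov_prod y z w \<le> b + \<delta>"
  using gromov_prod_min[of x y w z] assms by linarith

lemma four_point:
  "dist x z + dist y (w::'a) \<le> max (dist x y + dist z w) (dist x w + dist y z) + 2 * \<delta>"
proof -
  have "gromov_prod x y w \<le> gromov_prod x z w + \<delta> \<or> gromov_prod y z w \<le> gromov_prod x z w + \<delta>"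
    by (rule gromov_prod_split) simp
  then show ?thesis
  proof
    assume "gromov_prod x y w \<le> gromov_prod x z w + \<delta>"
    then have "dist x z + dist y w \<le> dist x y + dist z w + 2 * \<delta>"
      by (simp add: gromov_prod_def dist_commute field_simps)
    then show ?thesis by (rule order_trans) simp
  next
    assume "gromov_prod y z w \<le> gromov_prod x z w + \<delta>"
    then have "dist x z + dist y w \<le> dist x w + dist y z + 2 * \<delta>"
      by (simp add: gromov_prod_def dist_commute field_simps)
    then show ?thesis by (rule order_trans) simp
  qed
qed

lemma point_between:
  assumes "0 \<le> t" "t \<le> dist x (y::'a)"
  obtains z where "dist x z = t" "dist z y = dist x y - t"
proof -
  obtain c where c: "geodesic_seg c x y" using geodesic_exists by blast
  show ?thesis using that[of "c t"] geodesic_seg_dist_ends[OF c assms] by simp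
qed

end

locale hyp_action = group G + gromov_hyperbolic \<delta> T
  for G :: "('g, 'b) monoid_scheme" (structure) and \<delta> :: real and T :: "'a::metric_space itself" +
  fixes act :: "'g \<Rightarrow> 'a \<Rightarrow> 'a" and D :: real
  assumes isometric: "isometric_action G act"
    and proper: "proper_action G act"
    and cocompact: "quot_diam_le G act D"
begin

lemma act_one [simp]: "act \<one> x = x"
  using isometric by (simp add: isometric_action_def)

lemma act_mult: "g \<in> carrier G \<Longrightarrow> h \<in> carrier G \<Longrightarrow> act (g \<otimes> h) x = act g (act h x)"
  using isometric by (simp add: isometric_action_def)

lemma act_dist [simp]: "g \<in> carrier G \<Longrightarrow> dist (act g x) (act g y) = dist x y"
  using isometric by (simp add: isometric_action_def)

lemma act_gromov [simp]:
  "g \<in> carrier G \<Longrightarrow> gromov_prod (act g x) (act g y) (act g z) = gromov_prod x y z"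
  by (simp add: gromov_prod_def)

lemma act_inv [simp]: "g \<in> carrier G \<Longrightarrow> act (inv g) (act g x) = x"
  by (simp add: act_mult[symmetric])

lemma act_inv' [simp]: "g \<in> carrier G \<Longrightarrow> act g (act (inv g) x) = x"
  by (simp add: act_mult[symmetric])

lemma act_dist_swap:
  assumes "g \<in> carrier G"
  shows "dist (act g x) y = dist x (act (inv g) y)"
proof -
  have "dist (act g x) (act g (act (inv g) y)) = dist x (act (inv g) y)"
    by (rule act_dist[OF assms])
  then show ?thesis by (simp only: act_inv'[OF assms])
qed

lemma act_gromov_swap:
  assumes "g \<in> carrier G"
  shows "gromov_prod (act (inv g) x) y z = gromov_prod x (act g y) (act g z)"
proof -
  have "gromov_prod (act g (act (inv g) x)) (act g y) (act g z) = gromov_prod (act (inv g) x) y z"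
    by (rule act_gromov[OF assms])
  then show ?thesis by (simp only: act_inv'[OF assms])
qed

lemma finite_displacement: "finite {g \<in> carrier G. dist x (act g x) \<le> R}"
  using proper by (simp add: proper_action_def)

lemma orbit_near:
  assumes "\<epsilon> > 0"
  obtains g where "g \<in> carrier G" "dist x (act g y) < D + \<epsilon>"
proof -
  let ?S = "(\<lambda>g. dist x (act g y)) ` carrier G"
  have "Inf ?S \<le> D" using cocompact by (simp add: quot_diam_le_def quot_dist_def)
  then have "Inf ?S < D + \<epsilon>" using assms by linarith
  have "?S \<noteq> {}" using one_closed by blast
  from cInf_lessD[OF this \<open>Inf ?S < D + \<epsilon>\<close>]
  obtain s where "s \<in> ?S" "s < D + \<epsilon>" by blast
  then show ?thesis using that by auto
qed

lemma D_nonneg: "0 \<le> D"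
proof (rule field_le_epsilon)
  fix e :: real assume "e > 0"
  then obtain g where "dist undefined (act g undefined) < D + e" by (rule orbit_near)
  then show "0 \<le> D + e" using zero_le_dist[of undefined "act g undefined"] by linarith
qed

end

section \<open>Broken geodesics and commuting translations\<close>

context hyp_action
begin

abbreviation word :: "'g list \<Rightarrow> 'g" where
  "word us \<equiv> foldr (\<otimes>) us \<one>"

lemma word_closed [simp]: "set us \<subseteq> carrier G \<Longrightarrow> word us \<in> carrier G"
  by (induction us) auto

lemma word_replicate: "g \<in> carrier G \<Longrightarrow> word (replicate n g) = g [^] n"
  by (induction n) (simp_all add: nat_pow_comm[of g _ 1, simplified])

lemma word_displacement:
  fixes L :: real
  assumes "set us \<subseteq> carrier G" and "\<And>s. s \<in> set us \<Longrightarrow> dist y (act s y) \<le> L"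
  shows "dist y (act (word us) y) \<le> length us * L"
  using assms
proof (induction us)
  case (Cons s us)
  have "dist y (act (word (s # us)) y) \<le> dist y (act s y) + dist (act s y) (act s (act (word us) y))"
    using Cons.prems dist_triangle[of y "act s (act (word us) y)" "act s y"] by (simp add: act_mult)
  also have "\<dots> \<le> L + length us * L"
    using Cons by (simp add: add_mono)
  finally show ?case by (simp add: algebra_simps)
qed simp

text \<open>Local-to-global principle for the broken geodesics spelled by words: each corner only
  wastes \<open>A + \<delta>\<close>, so the direction of a word is the direction of its first letter.\<close>

lemma word_direction:
  assumes S: "S \<subseteq> carrier G"
    and corner: "\<And>s s'. s \<in> S \<Longrightarrow> s' \<in> S \<Longrightarrow> gromov_prod (act (inv s) y) (act s' y) y \<le> A"
    and long: "\<And>s. s \<in> S \<Longrightarrow> dist y (act s y) > 2 * A + 2 * \<delta>"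
    and "s \<in> S" "set us \<subseteq> S"
  shows "dist y (act s y) - A - \<delta> \<le> gromov_prod (act s y) (act (s \<otimes> word us) y) y"
  using assms(4,5)
proof (induction us arbitrary: s)
  case Nil
  have "0 \<le> A" using corner[OF Nil(1,1)] gromov_prod_nonneg order_trans by blast
  then show ?case using Nil S delta_pos by (auto simp: gromov_prod_def)
next
  case (Cons s2 us)
  have c: "s \<in> carrier G" "s2 \<in> carrier G" "set us \<subseteq> carrier G" using Cons.prems S by auto
  let ?v = "act (s2 \<otimes> word us) y"
  \<comment> \<open>By the induction hypothesis the rest \<open>?v\<close> of the word follows
    \<open>s2\<close> beyond \<open>A + \<delta>\<close>, so it is \<open>inv s\<close> from which
    \<open>?v\<close> parts early. Translating by \<open>s\<close> then moves this corner to
    \<open>act s y\<close>.\<close>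
  have "gromov_prod (act (inv s) y) (act s2 y) y \<le> A" using corner Cons.prems by simp
  then have "gromov_prod (act (inv s) y) ?v y \<le> A + \<delta> \<or> gromov_prod ?v (act s2 y) y \<le> A + \<delta>"
    by (rule gromov_prod_split)
  moreover have "A + \<delta> < gromov_prod (act s2 y) ?v y"
    using Cons.IH[of s2] Cons.prems long[of s2] by fastforce
  ultimately have "gromov_prod (act (inv s) y) ?v y \<le> A + \<delta>"
    by (simp add: gromov_prod_commute)
  then have "gromov_prod y (act s ?v) (act s y) \<le> A + \<delta>"
    using c by (simp add: act_gromov_swap)
  moreover have "gromov_prod (act s y) (act s ?v) y + gromov_prod y (act s ?v) (act s y) = dist (act s y) y"
    by (rule gromov_prod_add)
  ultimately show ?case using c by (simp add: act_mult dist_commute)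
qed

text \<open>The word follows its first letter beyond \<open>A + \<delta>\<close>, so whatever is
  transversal to that letter is transversal to the word, at the cost of one \<delta>.\<close>

lemma word_transversal:
  assumes S: "S \<subseteq> carrier G"
    and corner: "\<And>s s'. s \<in> S \<Longrightarrow> s' \<in> S \<Longrightarrow> gromov_prod (act (inv s) y) (act s' y) y \<le> A"
    and long: "\<And>s. s \<in> S \<Longrightarrow> dist y (act s y) > 2 * A + 2 * \<delta>"
    and us: "s \<in> S" "set us \<subseteq> S" and z: "gromov_prod z (act s y) y \<le> A"
  shows "gromov_prod z (act (s \<otimes> word us) y) y \<le> A + \<delta>"
proof -
  have "A + \<delta> < gromov_prod (act s y) (act (s \<otimes> word us) y) y"
    using word_direction[OF S corner long us] long[OF us(1)] by simp
  then show ?thesis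
    using gromov_prod_split[OF z, of "act (s \<otimes> word us) y"] by (simp add: gromov_prod_commute)
qed

lemma power_transversal:
  assumes h: "h \<in> carrier G" and a: "gromov_prod (act (inv h) u) (act h u) u \<le> a"
    and long: "dist u (act h u) > 2 * a + 2 * \<delta>" and z: "gromov_prod z (act h u) u \<le> a"
  shows "gromov_prod z (act (h [^] Suc n) u) u \<le> a + \<delta>"
proof -
  have "gromov_prod z (act (h \<otimes> word (replicate n h)) u) u \<le> a + \<delta>"
    by (rule word_transversal[of "{h}"]) (use assms in \<open>auto simp: set_replicate_conv_if\<close>)
  then show ?thesis by (simp only: word_replicate[OF h] nat_pow_Suc2[OF h])
qed

text \<open>Two applications of \<open>power_transversal\<close>, to the powers of
  \<open>inv h\<close> and then to those of \<open>h\<close>. The second starts from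
  \<open>a + \<delta>\<close>, which is why \<open>long\<close> asks for
  \<open>2 * a + 4 * \<delta>\<close>.\<close>

lemma power_two_sided:
  assumes h: "h \<in> carrier G" and a: "gromov_prod (act (inv h) u) (act h u) u \<le> a"
    and long: "dist u (act h u) > 2 * a + 4 * \<delta>"
  shows "gromov_prod (act (inv h [^] (i::nat)) u) (act (h [^] (j::nat)) u) u \<le> a + 2 * \<delta>"
proof (cases "i = 0 \<or> j = 0")
  case True
  have "0 \<le> a" using a gromov_prod_nonneg order_trans by blast
  then show ?thesis using True delta_pos by (auto simp: gromov_prod_def dist_commute)
next
  case False
  then obtain i' j' where ij: "i = Suc i'" "j = Suc j'" by (meson not0_implies_Suc)
  have d: "dist u (act (inv h) u) = dist u (act h u)"
    using h by (simp add: act_dist_swap[symmetric] dist_commute)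
  have "gromov_prod (act h u) (act (inv h [^] Suc i') u) u \<le> a + \<delta>"
    by (rule power_transversal) (use h a long d delta_pos in \<open>auto simp: gromov_prod_commute\<close>)
  then have "gromov_prod (act (inv h [^] Suc i') u) (act (h [^] Suc j') u) u \<le> a + \<delta> + \<delta>"
    using h a long d delta_pos by (intro power_transversal) (auto simp: gromov_prod_commute)
  then show ?thesis using ij by simp
qed

lemma int_pow_inj:
  assumes g: "g \<in> carrier G" and inf: "\<forall>n::nat. n > 0 \<longrightarrow> g [^] n \<noteq> \<one>" and eq: "g [^] (i::int) = g [^] j"
  shows "i = j"
proof -
  have *: "i = j" if "i \<le> j" "g [^] (i::int) = g [^] j" for i j
  proof (rule ccontr)
    assume "i \<noteq> j"
    have "g [^] (j - i) = \<one>" using g that by (simp add: int_pow_diff)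
    then have "g [^] int (nat (j - i)) = \<one>" using \<open>i \<le> j\<close> by simp
    then have "g [^] nat (j - i) = \<one>" by (simp only: int_pow_int)
    moreover have "nat (j - i) > 0" using \<open>i \<noteq> j\<close> \<open>i \<le> j\<close> by simp
    ultimately show False using inf by blast
  qed
  show ?thesis using *[of i j] *[of j i] eq by (cases "i \<le> j") auto
qed

lemma power_unbounded:
  assumes g: "g \<in> carrier G" and inf: "\<forall>n::nat. n > 0 \<longrightarrow> g [^] n \<noteq> \<one>"
  obtains n :: nat where "dist x (act (g [^] n) x) > R"
proof -
  have "\<exists>n::nat. dist x (act (g [^] n) x) > R"
  proof (rule ccontr)
    assume "\<not> (\<exists>n::nat. dist x (act (g [^] n) x) > R)"
    then have sub: "range (\<lambda>n::nat. g [^] n) \<subseteq> {k \<in> carrier G. dist x (act k x) \<le> R}"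
      using g by (auto simp: not_less)
    have "inj (\<lambda>n::nat. g [^] n)"
    proof (rule injI)
      fix m n :: nat assume "g [^] m = g [^] n"
      then have "g [^] int m = g [^] int n" by (simp add: int_pow_int)
      then show "m = n" using int_pow_inj[OF g inf] by fastforce
    qed
    then show False
      using finite_subset[OF sub finite_displacement] finite_imageD infinite_UNIV_nat by blast
  qed
  then show ?thesis using that by blast
qed

text \<open>The points of a long geodesic from \<open>x\<close> to \<open>\<gamma>\<^sup>n x\<close> are all moved by \<open>\<gamma>\<close> by a bounded amount.
  Transporting them near \<open>x\<close> leaves only finitely many configurations, so two coincide, and the
  element carrying one to the other centralises \<open>\<gamma>\<close> and translates along the geodesic.\<close>

lemma commuting_translation:
  assumes g: "\<gamma> \<in> carrier G" and inf: "\<forall>n::nat. n > 0 \<longrightarrow> \<gamma> [^] n \<noteq> \<one>"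
  obtains h u a where "h \<in> carrier G" "\<gamma> \<otimes> h = h \<otimes> \<gamma>"
    "gromov_prod (act (inv h) u) (act h u) u \<le> a" "dist u (act h u) > 2 * a + 4 * \<delta>"
proof -
  define x :: 'a where "x = undefined"
  define e where "e = dist x (act \<gamma> x)"
  define \<eta> where "\<eta> = 2 * (D + \<delta>)"
  \<comment> \<open>The spacing of the sample points: \<open>L - \<eta>\<close> must exceed
    \<open>2 * \<eta> + \<delta>\<close> for the corner estimate and
    \<open>4 * \<eta> + 6 * \<delta>\<close> for the length estimate at the end.\<close>
  define L where "L = 10 * \<eta> + 10 * \<delta>"
  have pos: "\<eta> > 0" "L > 0" using D_nonneg delta_pos by (simp_all add: \<eta>_def L_def)
  define F where "F = {k \<in> carrier G. dist x (act k x) \<le> \<eta> + (e + 2 * \<delta>)}"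
  define W where "W = {k \<in> carrier G. dist x (act k x) \<le> \<eta> + L}"
  have fin: "finite (F \<times> W)" unfolding F_def W_def by (intro finite_cartesian_product finite_displacement)
  \<comment> \<open>One index more than there are configurations, for the pigeonhole.\<close>
  define M where "M = Suc (card (F \<times> W))"
  obtain n :: nat where n: "dist x (act (\<gamma> [^] n) x) > M * L"
    using power_unbounded[OF g inf] by blast
  define q where "q = act (\<gamma> [^] n) x"
  obtain c where c: "geodesic_seg c x q" using geodesic_exists by blast
  define u where "u i = c (real i * L)" for i
  have uu: "dist (u i) (u j) = (real j - real i) * L" if "i \<le> j" "j \<le> M" for i j
  proof -
    have "real j * L \<le> real M * L" using that pos by (intro mult_right_mono) auto
    then have "real j * L \<le> dist x q" using n by (simp add: q_def)
    then have "dist (c (real i * L)) (c (real j * L)) = real j * L - real i * L"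
      using that pos by (intro geodesic_seg_dist[OF c]) (auto intro!: mult_right_mono)
    then show ?thesis by (simp add: u_def algebra_simps)
  qed
  \<comment> \<open>Both ends of the geodesic are moved by \<open>e\<close>, since \<gamma> commutes
    with its own powers; the four-point inequality passes this on to the points between.\<close>
  have moved: "dist (u i) (act \<gamma> (u i)) \<le> e + 2 * \<delta>" if "i \<le> M" for i
  proof -
    have "real i * L \<le> real M * L" using that pos by (intro mult_right_mono) auto
    then have "real i * L \<le> dist x q" using n by (simp add: q_def)
    then have 1: "dist x (u i) + dist (u i) q = dist x q"
      using geodesic_seg_dist_ends[OF c, of "real i * L"] pos by (simp add: u_def)
    have 2: "dist (act \<gamma> q) q = e"
      using g by (simp add: q_def e_def act_mult[symmetric] nat_pow_comm[of \<gamma> n 1, simplified] dist_commute)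
        (metis act_dist act_mult nat_pow_Suc nat_pow_Suc2 nat_pow_closed dist_commute)
    have 3: "dist (act \<gamma> (u i)) q \<le> dist (u i) q + e"
      using dist_triangle[of "act \<gamma> (u i)" q "act \<gamma> q"] 2 g by simp
    have 4: "dist x (act \<gamma> (u i)) \<le> dist x (u i) + e"
      using dist_triangle[of x "act \<gamma> (u i)" "act \<gamma> x"] g by (simp add: e_def)
    show ?thesis
      using four_point[of "u i" "act \<gamma> (u i)" x q] 1 3 4 by (simp add: dist_commute max_def split: if_splits)
  qed
  have "\<exists>k. k \<in> carrier G \<and> dist x (act k (u i)) < D + \<delta>" for i
    using orbit_near[OF delta_pos] by blast
  then obtain k where k: "\<And>i. k i \<in> carrier G" "\<And>i. dist x (act (k i) (u i)) < D + \<delta>" by metis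
  have transport: "dist x (act (k i \<otimes> s \<otimes> inv (k j)) x) \<le> \<eta> + dist (u i) (act s (u j))"
    if s: "s \<in> carrier G" for i j s
  proof -
    have "act (k i \<otimes> s \<otimes> inv (k j)) x = act (k i) (act s (act (inv (k j)) x))"
      using s k by (simp add: act_mult)
    moreover have "dist (act (k i) (act s (u j))) (act (k i) (act s (act (inv (k j)) x))) < D + \<delta>"
      using s k by (simp add: act_dist_swap[symmetric] dist_commute[of "u j"])
       (metis act_dist_swap dist_commute inv_closed inv_inv)
    moreover have "dist (act (k i) (u i)) (act (k i) (act s (u j))) = dist (u i) (act s (u j))"
      using k by simp
    ultimately show ?thesis
      using k(2)[of i] dist_triangle[of x "act (k i) (act s (act (inv (k j)) x))" "act (k i) (u i)"]
       dist_triangle[of "act (k i) (u i)" "act (k i) (act s (act (inv (k j)) x))" "act (k i) (act s (u j))"]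
      by (simp add: \<eta>_def)
  qed
  \<comment> \<open>The first component is \<gamma> read in the frame that brings \<open>u i\<close>
    near \<open>x\<close>; its coincidence gives commutation. The second is the step to the next
    sample point; its coincidence makes the same \<open>h\<close> carry the successor as well, which
    fixes the direction. The factor \<open>\<one>\<close> fits it to
    \<open>transport\<close>.\<close>
  define \<phi> where "\<phi> i = (k i \<otimes> \<gamma> \<otimes> inv (k i), k i \<otimes> \<one> \<otimes> inv (k (Suc i)))" for i
  have "\<phi> i \<in> F \<times> W" if "i < M" for i
    using that k g transport[OF g, of i i] moved[of i] transport[of \<one> i "Suc i"] uu[of i "Suc i"]
    by (auto simp: \<phi>_def F_def W_def)
  then have "\<phi> ` {..<M} \<subseteq> F \<times> W" by blast
  then have "\<not> inj_on \<phi> {..<M}"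
    using card_inj_on_le[of \<phi> "{..<M}" "F \<times> W"] fin by (auto simp: M_def)
  then obtain i j where ij: "i < j" "j < M" "\<phi> i = \<phi> j"
    by (auto simp: inj_on_def) (metis linorder_neqE_nat)
  define h where "h = inv (k j) \<otimes> k i"
  have h: "h \<in> carrier G" using k by (simp add: h_def)
  have "k i \<otimes> \<gamma> \<otimes> inv (k i) = k j \<otimes> \<gamma> \<otimes> inv (k j)" using ij by (simp add: \<phi>_def)
  then have "inv (k j) \<otimes> (k i \<otimes> \<gamma> \<otimes> inv (k i)) \<otimes> k i = inv (k j) \<otimes> (k j \<otimes> \<gamma> \<otimes> inv (k j)) \<otimes> k i"
    by simp
  then have comm: "\<gamma> \<otimes> h = h \<otimes> \<gamma>"
    using k g by (simp add: h_def m_assoc) (simp add: m_assoc[symmetric])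
  have "k i \<otimes> inv (k (Suc i)) = k j \<otimes> inv (k (Suc j))" using ij k by (simp add: \<phi>_def)
  then have "inv (k j) \<otimes> (k i \<otimes> inv (k (Suc i))) \<otimes> k (Suc i) = inv (k j) \<otimes> (k j \<otimes> inv (k (Suc j))) \<otimes> k (Suc i)"
    by simp
  then have h': "h = inv (k (Suc j)) \<otimes> k (Suc i)"
    using k by (simp add: h_def m_assoc) (simp add: m_assoc[symmetric])
  have near: "dist (act (inv (k m) \<otimes> k l) (u l)) (u m) \<le> \<eta>" for l m
  proof -
    have "dist (act (inv (k m) \<otimes> k l) (u l)) (u m) = dist (act (k l) (u l)) (act (k m) (u m))"
      using k(1) by (simp add: act_mult act_dist_swap)
    then show ?thesis
      using k(2)[of l] k(2)[of m] dist_triangle3[of "act (k l) (u l)" "act (k m) (u m)" x]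
      by (simp add: \<eta>_def)
  qed
  have hu: "dist (act h (u i)) (u j) \<le> \<eta>" using near by (simp add: h_def)
  have hv: "dist (act h (u (Suc i))) (u (Suc j)) \<le> \<eta>" using near by (simp add: h')
  define v where "v = act h (u (Suc i))"
  \<comment> \<open>\<open>u i\<close>, \<open>u j\<close>, \<open>u (Suc j)\<close> lie in order on
    the geodesic, so from \<open>act h (u i)\<close> the point \<open>v\<close> lies straight ahead.
    The second iterate of \<open>u i\<close> starts towards \<open>v\<close>, hence does not turn
    back to \<open>u i\<close>.\<close>
  have "gromov_prod (u i) (u (Suc j)) (u j) = 0"
    using uu[of i j] uu[of j "Suc j"] uu[of i "Suc j"] ij
    by (simp add: gromov_prod_def dist_commute algebra_simps)
  then have "gromov_prod (u i) v (act h (u i)) \<le> 2 * \<eta>"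
    using gromov_prod_perturb_base[of "u i" v "act h (u i)" "u j"]
      gromov_prod_perturb_point[of v "u i" "u j" "u (Suc j)"] hu hv
    by (simp add: gromov_prod_commute v_def)
  then have "gromov_prod (u i) (act h (act h (u i))) (act h (u i)) \<le> 2 * \<eta> + \<delta>
     \<or> gromov_prod (act h (act h (u i))) v (act h (u i)) \<le> 2 * \<eta> + \<delta>"
    by (rule gromov_prod_split)
  moreover have "gromov_prod (u j) (u (Suc i)) (u i) = L"
    using uu[of i j] uu[of i "Suc i"] uu[of "Suc i" j] ij
    by (simp add: gromov_prod_def dist_commute algebra_simps)
  then have "L - \<eta> \<le> gromov_prod (act h (act h (u i))) v (act h (u i))"
    using gromov_prod_perturb_point[of "u j" "u (Suc i)" "u i" "act h (u i)"] hu h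
    by (simp add: v_def dist_commute)
  ultimately have "gromov_prod (u i) (act h (act h (u i))) (act h (u i)) \<le> 2 * \<eta> + \<delta>"
    using pos delta_pos by (auto simp: L_def)
  then have A: "gromov_prod (act (inv h) (u i)) (act h (u i)) (u i) \<le> 2 * \<eta> + \<delta>"
    using h by (simp add: act_gromov_swap)
  have "1 * L \<le> (real j - real i) * L" using ij pos by (intro mult_right_mono) auto
  then have "L - \<eta> \<le> dist (u i) (act h (u i))"
    using uu[of i j] ij hu dist_triangle[of "u i" "u j" "act h (u i)"] by simp
  then have B: "dist (u i) (act h (u i)) > 2 * (2 * \<eta> + \<delta>) + 4 * \<delta>"
    using pos delta_pos by (simp add: L_def)
  show ?thesis by (rule that[OF h comm A B])
qed

end

section \<open>The quasi-axis of an element of infinite order\<close>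

context hyp_action
begin

lemma act_power_commute:
  assumes "g \<in> carrier G" "h \<in> carrier G" "g \<otimes> h = h \<otimes> g"
  shows "act (g [^] (m::nat)) (act (h [^] (n::nat)) x) = act (h [^] n) (act (g [^] m) x)"
proof -
  have 1: "g \<otimes> h [^] n = h [^] n \<otimes> g" for n :: nat
    using assms by (induction n) (simp_all add: m_assoc[symmetric], simp add: m_assoc)
  have "g [^] m \<otimes> h [^] n = h [^] n \<otimes> g [^] m"
  proof (induction m)
    case (Suc m)
    have "g [^] Suc m \<otimes> h [^] n = g [^] m \<otimes> (h [^] n \<otimes> g)"
      using assms 1 by (simp add: m_assoc)
    also have "\<dots> = h [^] n \<otimes> g [^] Suc m"
      using assms Suc by (simp add: m_assoc[symmetric])
    finally show ?case .
  qed (use assms in simp)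
  then show ?thesis using assms by (simp add: act_mult[symmetric])
qed

text \<open>The Busemann function of a sequence \<open>q\<close> whose points are moved by \<open>g\<close> by a bounded amount
  is a quasi-morphism of defect \<open>2\<delta>\<close> along the orbit of \<open>g\<close>.\<close>

lemma busemann_superadditive:
  assumes g: "g \<in> carrier G" and far: "filterlim (\<lambda>n. dist y (q n)) at_top sequentially"
    and bd: "\<And>(m::nat) n. dist (q n) (act (g [^] m) (q n)) \<le> B m"
  shows "eventually (\<lambda>n. real m * (dist (act g y) (q n) - dist y (q n) - 2 * \<delta>)
                \<le> dist (act (g [^] m) y) (q n) - dist y (q n)) sequentially"
proof (induction m)
  case (Suc m)
  have "eventually (\<lambda>n. dist y (q n) > dist y (act g y) + B m + \<delta>) sequentially"
    using far by (simp add: filterlim_at_top_dense)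
  with Suc show ?case
  proof eventually_elim
    case (elim n)
    let ?q' = "act (inv (g [^] m)) (q n)"
    have 1: "dist (act (g [^] Suc m) y) (q n) = dist (act g y) ?q'" "dist (act (g [^] m) y) (q n) = dist y ?q'"
      using g by (simp_all add: act_mult act_dist_swap)
    have 2: "dist (q n) ?q' \<le> B m" using g bd[of n m] by (simp add: act_dist_swap[symmetric] dist_commute)
    have "dist (act g y) (q n) + dist y ?q' \<le> max (dist (act g y) ?q' + dist y (q n)) (dist y (act g y) + dist (q n) ?q') + 2 * \<delta>"
      using four_point[of "act g y" "q n" ?q' y] by (simp add: dist_commute max_def add.commute)
    moreover have "dist (act g y) (q n) \<ge> dist y (q n) - dist y (act g y)"
      using dist_triangle[of y "q n" "act g y"] by simp
    moreover have "dist y ?q' \<ge> dist y (q n) - B m"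
      using dist_triangle[of y "q n" ?q'] 2 by (simp add: dist_commute)
    ultimately have "dist (act g y) (q n) - dist y (q n) - 2 * \<delta> \<le> dist (act g y) ?q' - dist y ?q'"
      using elim(2) 2 by (auto simp: max_def split: if_splits)
    then show ?case using elim(1) 1 by (simp add: algebra_simps)
  qed
qed simp

text \<open>\<open>y\<close> lies between the two ends of the orbit of an \<open>h\<close> commuting
  with \<gamma>. Points of that orbit are moved boundedly by powers of \<gamma>, so the Busemann
  estimate applies at both ends; the displacement of \<open>y\<close> shows almost fully at one end,
  and there it accumulates linearly.\<close>

lemma axis_point:
  assumes g: "\<gamma> \<in> carrier G" and inf: "\<forall>n::nat. n > 0 \<longrightarrow> \<gamma> [^] n \<noteq> \<one>"
  obtains y where "\<And>k m::nat. m > 0 \<Longrightarrow>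
    real m * (dist y (act (\<gamma> [^] k) y) - 8 * \<delta>) \<le> dist y (act (\<gamma> [^] (k * m)) y)"
proof -
  obtain h u a where h: "h \<in> carrier G" and comm: "\<gamma> \<otimes> h = h \<otimes> \<gamma>"
    and a: "gromov_prod (act (inv h) u) (act h u) u \<le> a" and long: "dist u (act h u) > 2 * a + 4 * \<delta>"
    using commuting_translation[OF g inf] by blast
  define G0 where "G0 = a + 2 * \<delta>"
  define p where "p n = act (inv h [^] (n::nat)) u" for n
  define q where "q n = act (h [^] (n::nat)) u" for n
  define F where "F n = dist u (q n)" for n
  have pq: "gromov_prod (p i) (q j) u \<le> G0" for i j
    unfolding p_def q_def G0_def by (rule power_two_sided[OF h a long])
  have invh: "inv h [^] n = inv (h [^] n)" for n :: nat using h by (simp add: nat_pow_inv)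
  have hp: "act (h [^] i) (p i) = u" for i using h by (simp add: p_def invh)
  have hq: "act (h [^] i) (q j) = q (i + j)" for i j
    using h by (simp add: q_def act_mult[symmetric] nat_pow_mult)
  have hp': "act (h [^] i) (p (i + j)) = p j" for i j
    using h by (simp add: p_def act_mult nat_pow_mult[symmetric]) (simp add: invh)
  have up: "dist u (p n) = F n" for n
    using h by (simp add: p_def F_def q_def invh act_dist_swap[symmetric] dist_commute)
  have pqd: "dist (p i) (q j) = F (i + j)" for i j
    using h act_dist[of "h [^] i" "p i" "q j"] by (simp add: hp hq F_def)
  have Fadd: "F i + F j - 2 * G0 \<le> F (i + j)" for i j
    using pq[of i j] up[of i] pqd[of i j] by (simp add: gromov_prod_def F_def)
  have F1: "F 1 > 2 * G0" using long h by (simp add: F_def q_def G0_def)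
  have Flin: "real n * (F 1 - 2 * G0) \<le> F n" for n
  proof (induction n)
    case (Suc n)
    then show ?case using Fadd[of n 1] by (simp add: algebra_simps)
  qed (simp add: F_def)
  have Ftop: "filterlim F at_top sequentially"
  proof (rule filterlim_at_top_mono[OF _ always_eventually])
    show "filterlim (\<lambda>n. real n * (F 1 - 2 * G0)) at_top sequentially"
      using F1 by (intro filterlim_at_top_mult_tendsto_pos[OF tendsto_const] filterlim_real_sequentially) auto
  qed (use Flin in blast)
  \<comment> \<open>\<open>p n\<close> and \<open>q n\<close> must agree with all later orbit points
    beyond 2 \<delta> as seen from \<open>y\<close>. One \<open>G0\<close> is lost in the two-sided
    bound, and \<open>G0 + 2 * \<delta>\<close> in moving the base point from \<open>u\<close> to
    \<open>y\<close>.\<close>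
  have "eventually (\<lambda>n. F n > 2 * G0 + 4 * \<delta>) sequentially"
    using Ftop unfolding filterlim_at_top_dense by blast
  then obtain n where n: "F n > 2 * G0 + 4 * \<delta>"
    by (auto simp: eventually_sequentially)
  have "0 \<le> dist (p n) (q n) / 2" "dist (p n) (q n) / 2 \<le> dist (p n) (q n)" by auto
  then obtain y where y: "dist (p n) y = dist (p n) (q n) / 2" "dist y (q n) = dist (p n) (q n) - dist (p n) (q n) / 2"
    using point_between by blast
  have yu: "dist y u \<le> G0 + 2 * \<delta>"
    using four_point[of y u "p n" "q n"] y up[of n] pq[of n n]
    by (simp add: dist_commute max_def gromov_prod_def F_def split: if_splits)
  have qfar: "filterlim (\<lambda>n. dist y (q n)) at_top sequentially"
  proof (rule filterlim_at_top_mono[OF _ always_eventually])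
    show "filterlim (\<lambda>n. - dist y u + F n) at_top sequentially"
      by (intro filterlim_tendsto_add_at_top[OF tendsto_const] Ftop)
    have "F n \<le> dist y u + dist y (q n)" for n
      using dist_triangle[of u "q n" y] by (simp add: F_def dist_commute)
    then show "\<forall>n. - dist y u + F n \<le> dist y (q n)" by (simp add: algebra_simps)
  qed
  have pfar: "filterlim (\<lambda>n. dist y (p n)) at_top sequentially"
  proof (rule filterlim_at_top_mono[OF _ always_eventually])
    show "filterlim (\<lambda>n. - dist y u + F n) at_top sequentially"
      by (intro filterlim_tendsto_add_at_top[OF tendsto_const] Ftop)
    have "F n \<le> dist y u + dist y (p n)" for n
      using dist_triangle[of u "p n" y] up[of n] by (simp add: dist_commute)
    then show "\<forall>n. - dist y u + F n \<le> dist y (p n)" by (simp add: algebra_simps)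
  qed
  have qq: "gromov_prod (q n) (q N) y > 2 * \<delta>" if "n \<le> N" for N
  proof -
    have "gromov_prod u (q N) (q n) \<le> G0"
      using act_gromov[of "h [^] n" "p n" "q (N - n)" u] pq[of n "N - n"] h that
      by (simp add: hp hq) (simp add: q_def)
    then have "gromov_prod (q n) (q N) u \<ge> F n - G0"
      using gromov_prod_add[of "q n" "q N" u] by (simp add: F_def dist_commute)
    then show ?thesis using gromov_prod_perturb_base[of "q n" "q N" u y] yu n by (simp add: dist_commute)
  qed
  have pp: "gromov_prod (p n) (p N) y > 2 * \<delta>" if "n \<le> N" for N
  proof -
    have "gromov_prod u (p N) (p n) \<le> G0"
      using act_gromov[of "h [^] n" u "p N" "p n"] pq[of "N - n" n] h that hp'[of n "N - n"]
        gromov_prod_commute[of "q n" "p (N - n)" u]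
      by (simp add: hp q_def)
    then have "gromov_prod (p n) (p N) u \<ge> F n - G0"
      using gromov_prod_add[of "p n" "p N" u] up[of n] by (simp add: dist_commute)
    then show ?thesis using gromov_prod_perturb_base[of "p n" "p N" u y] yu n by (simp add: dist_commute)
  qed
  \<comment> \<open>\<open>y\<close> is on a segment from \<open>p n\<close> to \<open>q n\<close>;
    replacing each end by a later orbit point costs \<delta>.\<close>
  have straight: "gromov_prod (p N) (q N) y \<le> 2 * \<delta>" if "n \<le> N" for N
  proof -
    have "gromov_prod (p n) (q n) y \<le> 0" using y by (simp add: gromov_prod_def dist_commute)
    from gromov_prod_split[OF this, of "p N"] have "gromov_prod (p N) (q n) y \<le> \<delta>"
      using pp[OF that] delta_pos by simp
    from gromov_prod_split[OF this, of "q N"] show ?thesis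
      using qq[OF that] by (simp add: gromov_prod_commute)
  qed
  have "real m * (dist y (act (\<gamma> [^] k) y) - 8 * \<delta>) \<le> dist y (act (\<gamma> [^] (k * m)) y)" if "m > 0" for k m :: nat
  proof -
    define g where "g = \<gamma> [^] k"
    have gc: "g \<in> carrier G" using g by (simp add: g_def)
    have gm: "g [^] i = \<gamma> [^] (k * i)" for i :: nat using g by (simp add: g_def nat_pow_pow)
    have comm': "\<gamma> \<otimes> inv h = inv h \<otimes> \<gamma>"
      using comm g h by (metis inv_closed inv_solve_left inv_solve_right m_assoc m_closed)
    have bq: "dist (q N) (act (g [^] i) (q N)) \<le> dist u (act (g [^] i) u)" for i N :: nat
      using h g by (simp add: q_def gm act_power_commute[OF g h comm])
    have bp: "dist (p N) (act (g [^] i) (p N)) \<le> dist u (act (g [^] i) u)" for i N :: nat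
      using h g by (simp add: p_def gm act_power_commute[OF g _ comm'])
    have "eventually (\<lambda>N. N \<ge> n) sequentially" by (rule eventually_ge_at_top)
    then have "eventually (\<lambda>N. real m * (dist y (act g y) - 8 * \<delta>) \<le> dist y (act (g [^] m) y)) sequentially"
      using busemann_superadditive[OF gc qfar bq, of m] busemann_superadditive[OF gc pfar bp, of m]
    proof eventually_elim
      case (elim N)
      let ?P = "dist (act g y) (p N) - dist y (p N) - 2 * \<delta>"
      let ?Q = "dist (act g y) (q N) - dist y (q N) - 2 * \<delta>"
      \<comment> \<open>The 8 \<delta>: two from the four-point inequality, four from
        \<open>straight\<close> (a Gromov product, hence doubled), two from the defect in
        \<open>?P\<close> and \<open>?Q\<close>.\<close>
      have "dist y (act g y) - 8 * \<delta> \<le> ?P \<or> dist y (act g y) - 8 * \<delta> \<le> ?Q"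
        using four_point[of y "act g y" "p N" "q N"] straight[OF elim(1)]
        by (simp add: gromov_prod_def dist_commute max_def split: if_splits)
      moreover have "real m * ?Q \<le> dist y (act (g [^] m) y)"
        using elim(2) dist_triangle[of "act (g [^] m) y" "q N" y] by (simp add: dist_commute)
      moreover have "real m * ?P \<le> dist y (act (g [^] m) y)"
        using elim(3) dist_triangle[of "act (g [^] m) y" "p N" y] by (simp add: dist_commute)
      ultimately show ?case
        using mult_left_mono[of "dist y (act g y) - 8 * \<delta>" ?P "real m"]
          mult_left_mono[of "dist y (act g y) - 8 * \<delta>" ?Q "real m"] by fastforce
    qed
    then have "real m * (dist y (act g y) - 8 * \<delta>) \<le> dist y (act (g [^] m) y)" by simp
    then show ?thesis by (simp only: gm) (simp only: g_def)
  qed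
  then show ?thesis by (rule that)
qed

text \<open>\<open>l\<close> is the infimum of the quotients \<open>f m / m\<close>, which gives the
  lower bound; \<open>axis_point\<close> and subadditivity compare each \<open>f k\<close> with
  every quotient and give the upper one. With \<open>l = 0\<close> the orbit would be bounded,
  against infinite order.\<close>

lemma axis_exists:
  assumes g: "\<gamma> \<in> carrier G" and inf: "\<forall>n::nat. n > 0 \<longrightarrow> \<gamma> [^] n \<noteq> \<one>"
  obtains y l where "l > 0" "\<And>k::nat. real k * l \<le> dist y (act (\<gamma> [^] k) y)"
    "\<And>k::nat. dist y (act (\<gamma> [^] k) y) \<le> real k * l + 8 * \<delta>"
proof -
  obtain y where y: "\<And>k m::nat. m > 0 \<Longrightarrow>
    real m * (dist y (act (\<gamma> [^] k) y) - 8 * \<delta>) \<le> dist y (act (\<gamma> [^] (k * m)) y)"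
    using axis_point[OF g inf] by blast
  define f where "f k = dist y (act (\<gamma> [^] (k::nat)) y)" for k
  have fmult: "f (k * m) \<le> real k * f m" for k m
  proof (induction k)
    case (Suc k)
    have "f (Suc k * m) \<le> f m + f (k * m)"
      using g dist_triangle[of y "act (\<gamma> [^] (m + k * m)) y" "act (\<gamma> [^] m) y"]
      by (simp add: f_def nat_pow_mult[symmetric] act_mult)
    then show ?case using Suc by (simp add: algebra_simps)
  qed (simp add: f_def)
  have key: "f k - 8 * \<delta> \<le> real k * (f m / real m)" if "m > 0" for k m
    using y[OF that, of k] fmult[of k m] that by (simp add: f_def field_simps)
  let ?S = "(\<lambda>m. f m / real m) ` {m. m > 0}"
  define l where "l = Inf ?S"
  have ne: "?S \<noteq> {}" by auto
  have bdd: "bdd_below ?S" by (intro bdd_belowI[of _ 0]) (auto simp: f_def)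
  have l0: "0 \<le> l" unfolding l_def by (intro cInf_greatest[OF ne]) (auto simp: f_def)
  have low: "real k * l \<le> f k" for k
  proof (cases "k = 0")
    case False
    then have "l \<le> f k / real k" unfolding l_def by (intro cInf_lower[OF _ bdd]) auto
    then show ?thesis using False by (simp add: field_simps)
  qed (simp add: f_def)
  have up: "f k \<le> real k * l + 8 * \<delta>" for k
  proof (cases "k = 0")
    case False
    have "(f k - 8 * \<delta>) / real k \<le> l" unfolding l_def
      using key False by (intro cInf_greatest[OF ne]) (auto simp: field_simps)
    then show ?thesis using False by (simp add: field_simps)
  qed (use delta_pos in \<open>simp add: f_def\<close>)
  have "l \<noteq> 0"
  proof
    assume "l = 0"
    obtain n :: nat where "f n > 8 * \<delta>" using power_unbounded[OF g inf] f_def by metis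
    then show False using up[of n] \<open>l = 0\<close> by simp
  qed
  then show ?thesis using that[of l y] l0 low up by (simp add: f_def)
qed

end

section \<open>Entropy of free semigroups\<close>

context hyp_action
begin

text \<open>Cancelling first letters via \<open>first\<close> makes words of equal length distinct,
  so there are \<open>card S ^ n\<close> elements of displacement at most \<open>n * L\<close> at
  \<open>y\<close>. Passing to \<open>x\<close> costs only a constant.\<close>

lemma entropy_gt:
  assumes S: "S \<subseteq> carrier G" "finite S" "S \<noteq> {}"
    and disp: "\<And>s. s \<in> S \<Longrightarrow> dist y (act s y) \<le> L" and "L > 0"
    and first: "\<And>s s' us vs. \<lbrakk>s \<in> S; s' \<in> S; set us \<subseteq> S; set vs \<subseteq> S; length us = length vs;
      s \<otimes> word us = s' \<otimes> word vs\<rbrakk> \<Longrightarrow> s = s'"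
    and c: "0 \<le> c" "c < ln (card S) / L"
  shows "entropy G act x > ereal c"
proof -
  define W where "W n = {us. set us \<subseteq> S \<and> length us = n}" for n
  have inj: "us = vs" if "us \<in> W n" "vs \<in> W n" "word us = word vs" for us vs n
    using that
  proof (induction us arbitrary: vs n)
    case (Cons s us)
    then obtain s' vs' where vs: "vs = s' # vs'" by (cases vs) (auto simp: W_def)
    have in_S: "s \<in> S" "s' \<in> S" "set us \<subseteq> S" "set vs' \<subseteq> S" "length us = length vs'"
      using Cons.prems vs by (auto simp: W_def)
    have eq: "s \<otimes> word us = s' \<otimes> word vs'" using Cons.prems(3) vs by simp
    have "s = s'" by (rule first[OF in_S eq])
    moreover from this have "word us = word vs'" using eq in_S S(1) by (auto simp: subset_iff)
    ultimately show ?case using Cons.IH[of "length us" vs'] in_S vs by (simp add: W_def)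
  qed (simp add: W_def)
  define d where "d = dist x y"
  have cardS: "card S \<ge> 1" using S by (simp add: Suc_leI card_gt_0_iff)
  have count: "real n * ln (card S) \<le> ln (card {g \<in> carrier G. dist x (act g x) < R})"
    if "real n * L + 2 * d < R" for n :: nat and R
  proof -
    let ?B = "{g \<in> carrier G. dist x (act g x) < R}"
    have "word ` W n \<subseteq> ?B"
    proof clarify
      fix us assume us: "us \<in> W n"
      then have usS: "set us \<subseteq> S" "length us = n" by (auto simp: W_def)
      then have w: "word us \<in> carrier G" using S by auto
      have "dist y (act (word us) y) \<le> real n * L"
        using word_displacement[of us y L] usS S disp by auto
      then have "dist x (act (word us) x) < R"
        using that w dist_triangle[of x "act (word us) x" y]
          dist_triangle[of y "act (word us) x" "act (word us) y"]
        by (simp add: d_def dist_commute)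
      then show "word us \<in> carrier G \<and> dist x (act (word us) x) < R" using w by simp
    qed
    moreover have "finite ?B"
      by (rule finite_subset[OF _ finite_displacement[of x R]]) auto
    ultimately have "card (word ` W n) \<le> card ?B" by (intro card_mono)
    moreover have "card (word ` W n) = card S ^ n"
      using inj card_lists_length_eq[OF S(2), of n] by (subst card_image) (auto simp: inj_on_def W_def)
    ultimately have "card S ^ n \<le> card ?B" by simp
    then have "real (card S) ^ n \<le> card ?B" by (metis of_nat_le_iff of_nat_power)
    then have "ln (real (card S) ^ n) \<le> ln (card ?B)"
      using cardS by (intro ln_mono) auto
    then show ?thesis using cardS by (simp add: ln_realpow)
  qed
  define \<kappa> where "\<kappa> = ln (card S) / L"
  \<comment> \<open>A rate strictly in between keeps the inequality strict after the lower limit;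
    beyond \<open>R0\<close> the gap to \<open>\<kappa>\<close> absorbs the change of base point and
    the rounding of \<open>n\<close>.\<close>
  obtain c' where c': "c < c'" "c' < \<kappa>" using c dense unfolding \<kappa>_def by blast
  define R0 where "R0 = max (2 * d + 1) (\<kappa> * (2 * d + 1 + L) / (\<kappa> - c'))"
  have "ereal c' \<le> ereal (ln (card {g \<in> carrier G. dist x (act g x) < R}) / R)" if R: "R0 \<le> R" for R
  proof -
    define n where "n = nat \<lfloor>(R - 2 * d - 1) / L\<rfloor>"
    have R1: "2 * d + 1 \<le> R" and "\<kappa> * (2 * d + 1 + L) / (\<kappa> - c') \<le> R" using R by (simp_all add: R0_def)
    then have R2: "\<kappa> * (2 * d + 1 + L) \<le> R * (\<kappa> - c')" using c' by (simp add: pos_divide_le_eq)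
    have "0 \<le> (R - 2 * d - 1) / L" using R1 \<open>L > 0\<close> by simp
    then have "real n \<le> (R - 2 * d - 1) / L" "(R - 2 * d - 1) / L < real n + 1"
      unfolding n_def by linarith+
    then have n: "real n * L + 2 * d < R" "R - 2 * d - 1 - L \<le> real n * L"
      using \<open>L > 0\<close> by (simp_all add: field_simps)
    have "c' * R \<le> \<kappa> * (R - 2 * d - 1 - L)" using R2 by (simp add: algebra_simps)
    also have "\<dots> \<le> \<kappa> * (real n * L)" using n(2) c c' by (intro mult_left_mono) auto
    also have "\<dots> = real n * ln (card S)" using \<open>L > 0\<close> by (simp add: \<kappa>_def)
    also have "\<dots> \<le> ln (card {g \<in> carrier G. dist x (act g x) < R})" by (rule count[OF n(1)])
    finally have "c' * R \<le> ln (card {g \<in> carrier G. dist x (act g x) < R})" .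
    moreover have "0 < R" using R1 zero_le_dist[of x y] unfolding d_def by linarith
    ultimately show ?thesis by (simp add: pos_le_divide_eq)
  qed
  then have "ereal c' \<le> entropy G act x"
    unfolding entropy_def by (intro Liminf_bounded) (auto simp: eventually_at_top_linorder)
  then show ?thesis using c'(1) by (meson ereal_less_eq(3) less_ereal.simps(1) less_le_trans)
qed

end

section \<open>Translates of the quasi-axis\<close>

text \<open>The orbit is a quasi-line with additive error 8 \<delta>. The bound \<open>l_le\<close>
  lets any nonnegative threshold be passed by a multiple of \<open>l\<close> with an excess of at
  most \<delta>.\<close>

locale axis = hyp_action G \<delta> T act D
  for G :: "('g, 'b) monoid_scheme" (structure) and \<delta> :: real and T :: "'a::metric_space itself"
    and act :: "'g \<Rightarrow> 'a \<Rightarrow> 'a" and D :: real +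
  fixes \<gamma> :: 'g and y :: 'a and l :: real
  assumes gamma: "\<gamma> \<in> carrier G" and l_pos: "l > 0" and l_le: "l \<le> \<delta>"
    and low: "\<And>k::nat. real k * l \<le> dist y (act (\<gamma> [^] k) y)"
    and up: "\<And>k::nat. dist y (act (\<gamma> [^] k) y) \<le> real k * l + 8 * \<delta>"
begin

definition ax :: "int \<Rightarrow> 'a" where "ax k = act (\<gamma> [^] k) y"

lemma ax_0 [simp]: "ax 0 = y" by (simp add: ax_def)

lemma act_ax [simp]: "act (\<gamma> [^] (i::int)) (ax j) = ax (i + j)"
  using gamma by (simp add: ax_def act_mult[symmetric] int_pow_mult)

lemma act_ax_0 [simp]: "act (\<gamma> [^] (i::int)) y = ax i"
  by (simp add: ax_def)

lemma ax_dist_le: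
  assumes "i \<le> j"
  shows "(real_of_int j - real_of_int i) * l \<le> dist (ax i) (ax j)"
    "dist (ax i) (ax j) \<le> (real_of_int j - real_of_int i) * l + 8 * \<delta>"
proof -
  have "dist (ax i) (ax j) = dist (act (\<gamma> [^] i) y) (act (\<gamma> [^] i) (ax (j - i)))"
    by simp
  also have "\<dots> = dist y (ax (j - i))" using gamma by (intro act_dist) simp
  also have "ax (j - i) = act (\<gamma> [^] int (nat (j - i))) y" using assms by (simp add: ax_def del: act_ax_0)
  also have "\<dots> = act (\<gamma> [^] nat (j - i)) y" by (simp only: int_pow_int)
  finally have d: "dist (ax i) (ax j) = dist y (act (\<gamma> [^] nat (j - i)) y)" .
  have r: "real (nat (j - i)) = real_of_int j - real_of_int i" using assms by simp
  show "(real_of_int j - real_of_int i) * l \<le> dist (ax i) (ax j)"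
    "dist (ax i) (ax j) \<le> (real_of_int j - real_of_int i) * l + 8 * \<delta>"
    using low[of "nat (j - i)"] up[of "nat (j - i)"] unfolding d r by blast+
qed

lemma ax_dist: "real_of_int \<bar>i - j\<bar> * l \<le> dist (ax i) (ax j)"
  "dist (ax i) (ax j) \<le> real_of_int \<bar>i - j\<bar> * l + 8 * \<delta>"
proof -
  have "real_of_int \<bar>i - j\<bar> * l \<le> dist (ax i) (ax j) \<and> dist (ax i) (ax j) \<le> real_of_int \<bar>i - j\<bar> * l + 8 * \<delta>"
  proof (cases "i \<le> j")
    case True
    then have "real_of_int \<bar>i - j\<bar> = real_of_int j - real_of_int i" by linarith
    then show ?thesis using ax_dist_le[OF True] by simp
  next
    case False
    then have "real_of_int \<bar>i - j\<bar> = real_of_int i - real_of_int j" by linarith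
    then show ?thesis using ax_dist_le[of j i] False unfolding dist_commute[of "ax i"] by simp
  qed
  then show "real_of_int \<bar>i - j\<bar> * l \<le> dist (ax i) (ax j)"
    "dist (ax i) (ax j) \<le> real_of_int \<bar>i - j\<bar> * l + 8 * \<delta>" by blast+
qed

lemma y_ax_dist: "real_of_int \<bar>i\<bar> * l \<le> dist y (ax i)" "dist y (ax i) \<le> real_of_int \<bar>i\<bar> * l + 8 * \<delta>"
  using ax_dist[of 0 i] by simp_all

lemma ax_inj:
  assumes "\<gamma> [^] (i::int) = \<gamma> [^] j"
  shows "i = j"
proof (rule ccontr)
  assume "i \<noteq> j"
  then have "1 * l \<le> real_of_int \<bar>i - j\<bar> * l" using l_pos by (intro mult_right_mono) linarith+
  from order_trans[OF this ax_dist(1)] show False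
    using assms l_pos by (simp add: ax_def del: act_ax_0)
qed

lemma ax_between:
  assumes "i \<le> j" "j \<le> k"
  shows "gromov_prod (ax i) (ax k) (ax j) \<le> 8 * \<delta>"
proof -
  have "(real_of_int k - real_of_int i) * l = (real_of_int j - real_of_int i) * l + (real_of_int k - real_of_int j) * l"
    by (simp add: algebra_simps)
  then have "dist (ax i) (ax j) + dist (ax j) (ax k) - dist (ax i) (ax k) \<le> 16 * \<delta>"
    using ax_dist_le(2)[OF assms(1)] ax_dist_le(2)[OF assms(2)] ax_dist_le(1)[OF order_trans[OF assms]]
    by linarith
  then show ?thesis by (simp add: gromov_prod_def dist_commute)
qed

text \<open>If \<open>y\<close> is the point of its orbit closest to \<open>w\<close>, then \<open>w\<close> is seen from \<open>y\<close> transversally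
  to the orbit; the bound is read off at an orbit point at distance about \<open>18\<delta>\<close>.\<close>

lemma nearest_transversal:
  assumes near: "\<And>k. dist w y \<le> dist w (ax k)"
  shows "gromov_prod w (ax k) y \<le> 15 * \<delta>"
proof -
  have half: "gromov_prod w (ax i) y \<le> (real_of_int \<bar>i\<bar> * l + 8 * \<delta>) / 2" for i
    using near[of i] y_ax_dist(2)[of i] by (simp add: gromov_prod_def dist_commute)
  \<comment> \<open>The test point has \<open>n * l\<close> between 18 \<delta> and 19 \<delta>:
    above 18 \<delta>, the product \<open>N - 4 * \<delta>\<close> along the orbit beats
    \<open>(N + 8 * \<delta>) / 2 + \<delta>\<close>; below 19 \<delta>, the latter stays under 15
    \<delta>.\<close>
  define n where "n = \<lfloor>18 * \<delta> / l\<rfloor> + 1"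
  have "18 * \<delta> / l < real_of_int n" "real_of_int n \<le> 18 * \<delta> / l + 1" unfolding n_def by linarith+
  then have n1: "18 * \<delta> < real_of_int n * l" and "real_of_int n * l \<le> (18 * \<delta> / l + 1) * l"
    using l_pos by (simp_all add: pos_divide_less_eq)
  moreover have "(18 * \<delta> / l + 1) * l = 18 * \<delta> + l" using l_pos by (simp add: distrib_right)
  ultimately have n: "18 * \<delta> < real_of_int n * l" "real_of_int n * l \<le> 19 * \<delta>"
    using l_le by linarith+
  have "0 < 18 * \<delta> / l" using delta_pos l_pos by simp
  then have n0: "0 < n" by (simp add: n_def add_nonneg_pos)
  show ?thesis
  proof (cases "\<bar>k\<bar> \<le> n")
    case True
    then have "real_of_int \<bar>k\<bar> * l \<le> real_of_int n * l"
      using l_pos by (intro mult_right_mono) linarith+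
    then have "(real_of_int \<bar>k\<bar> * l + 8 * \<delta>) / 2 \<le> (real_of_int n * l + 8 * \<delta>) / 2" by simp
    also have "\<dots> \<le> 15 * \<delta>" using n delta_pos by simp
    finally show ?thesis by (rule order_trans[OF half])
  next
    case False
    define i where "i = sgn k * n"
    have i: "\<bar>i\<bar> = n" "\<bar>i - k\<bar> = \<bar>k\<bar> - n" using False n0 by (auto simp: i_def abs_mult sgn_if)
    define N K where "N = real_of_int n * l" and "K = real_of_int \<bar>k\<bar> * l"
    have "real_of_int (\<bar>k\<bar> - n) * l = K - N" by (simp add: N_def K_def left_diff_distrib)
    then have "N \<le> dist y (ax i)" "K \<le> dist y (ax k)" "dist (ax k) (ax i) \<le> K - N + 8 * \<delta>"
      using y_ax_dist(1)[of i] y_ax_dist(1)[of k] ax_dist(2)[of i k]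
      by (simp_all only: i N_def K_def dist_commute[of "ax k"])
    then have ki: "N - 4 * \<delta> \<le> gromov_prod (ax k) (ax i) y" unfolding gromov_prod_def by argo
    have n': "18 * \<delta> < N" "N \<le> 19 * \<delta>" using n by (simp_all add: N_def)
    have "gromov_prod w (ax i) y \<le> (N + 8 * \<delta>) / 2" using half[of i] by (simp only: i N_def)
    from gromov_prod_split[OF this, of "ax k"] show ?thesis using ki n' delta_pos by argo
  qed
qed

end

section \<open>Transversal translates of the axis and the words that cross over to them\<close>

locale transversal = axis G \<delta> T act D \<gamma> y l
  for G :: "('g, 'b) monoid_scheme" (structure) and \<delta> :: real and T :: "'a::metric_space itself"
    and act :: "'g \<Rightarrow> 'a \<Rightarrow> 'a" and D :: real and \<gamma> y l +
  fixes g :: 'g and e :: int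
  assumes g: "g \<in> carrier G" and e: "e = 1 \<or> e = -1"
    and near: "\<And>k. dist (act g y) y \<le> dist (act g y) (ax k)"
    and far: "26 * \<delta> \<le> dist y (act g y)"
    and outward: "\<And>j::nat. gromov_prod (act g (ax (e * int j))) y (act g y) \<le> 9 * \<delta>"
begin

abbreviation t where "t \<equiv> dist y (act g y)"

text \<open>From \<open>y\<close>, the outward half of the translated axis lies behind
  \<open>act g y\<close>: the two agree for \<open>t - 9 * \<delta>\<close>, at least 17 \<delta> by
  \<open>far\<close>. So it inherits the 15 \<delta> of the nearest-point estimate, plus one
  \<delta>.\<close>

lemma cross: "gromov_prod (act g (ax (e * int j))) (ax k) y \<le> 16 * \<delta>"
proof -
  let ?W = "act g (ax (e * int j))"
  have "17 * \<delta> \<le> gromov_prod (act g y) ?W y"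
    using gromov_prod_add[of y ?W "act g y"] outward[of j] far by (simp add: gromov_prod_commute)
  then show ?thesis
    using gromov_prod_split[OF nearest_transversal[OF near, of k], of ?W] delta_pos by auto
qed

text \<open>Cross over to the translated axis, then follow it outwards for \<open>k\<close> steps;
  \<open>e\<close> selects the outward half.\<close>

definition letter :: "nat \<Rightarrow> 'g" where "letter k = g \<otimes> \<gamma> [^] (e * int k)"

lemma letter_closed [simp]: "letter k \<in> carrier G"
  using g gamma by (simp add: letter_def)

lemma act_letter: "act (letter k) y = act g (ax (e * int k))"
  using g gamma by (simp add: letter_def act_mult)

lemma abs_e [simp]: "\<bar>e * k\<bar> = \<bar>k\<bar>" "\<bar>e\<bar> = 1"
  using e by auto

lemma letter_dist:
  "t + real k * l - 18 * \<delta> \<le> dist y (act (letter k) y)"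
  "dist y (act (letter k) y) \<le> t + real k * l + 8 * \<delta>"
proof -
  have d: "dist (act g y) (act (letter k) y) = dist y (ax (e * int k))"
    using g by (simp add: act_letter)
  show "t + real k * l - 18 * \<delta> \<le> dist y (act (letter k) y)"
    using outward[of k] d y_ax_dist(1)[of "e * int k"] by (simp add: gromov_prod_def act_letter dist_commute)
  show "dist y (act (letter k) y) \<le> t + real k * l + 8 * \<delta>"
    using dist_triangle[of y "act (letter k) y" "act g y"] d y_ax_dist(2)[of "e * int k"] by simp
qed

text \<open>The inverse letter amounts to running back along the axis for about \<open>k * l\<close>
  and then straying by only \<open>t\<close>, so it still points along the axis, to which the next
  letter is transversal by \<open>cross\<close>.\<close>

lemma letter_corner:
  assumes "real k * l > t + 17 * \<delta>"
  shows "gromov_prod (act (inv (letter k)) y) (act (letter k') y) y \<le> 17 * \<delta>"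
proof -
  let ?Z = "act (inv (letter k)) y" and ?Y = "ax (- (e * int k))"
  have "?Z = act (\<gamma> [^] (- (e * int k))) (act (inv g) y)"
    using g gamma by (simp add: letter_def inv_mult_group act_mult int_pow_neg)
  then have "dist ?Z ?Y = dist (act (inv g) y) y"
    using gamma act_dist[of "\<gamma> [^] (- (e * int k))" "act (inv g) y" y] by simp
  then have "dist ?Z ?Y = t" using g act_dist_swap[of "inv g" y y] by simp
  then have "17 * \<delta> < gromov_prod ?Y ?Z y"
    using assms y_ax_dist(1)[of "- (e * int k)"] dist_triangle[of y ?Y ?Z]
    by (simp add: gromov_prod_def dist_commute)
  moreover have "gromov_prod ?Y (act (letter k') y) y \<le> 16 * \<delta>"
    using cross[of k'] by (simp add: act_letter gromov_prod_commute)
  ultimately show ?thesis using gromov_prod_split[of ?Y "act (letter k') y" y "16 * \<delta>" ?Z] by auto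
qed

lemma letter_long:
  assumes "real k * l > t + 17 * \<delta>"
  shows "dist y (act (letter k) y) > 2 * (17 * \<delta>) + 2 * \<delta>"
  using letter_dist(1)[of k] assms far delta_pos by simp

lemma letters_words:
  assumes K: "\<And>k. k \<in> K \<Longrightarrow> real k * l > t + 17 * \<delta>" and k: "k \<in> K" and us: "set us \<subseteq> letter ` K"
  shows "dist y (act (letter k) y) - 18 * \<delta> \<le> gromov_prod (act (letter k) y) (act (letter k \<otimes> word us) y) y"
    and "gromov_prod (ax m) (act (letter k \<otimes> word us) y) y \<le> 18 * \<delta>"
proof -
  have S: "letter ` K \<subseteq> carrier G" by auto
  have corner: "gromov_prod (act (inv s) y) (act s' y) y \<le> 17 * \<delta>" if "s \<in> letter ` K" "s' \<in> letter ` K" for s s'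
    using that K letter_corner by auto
  have long: "dist y (act s y) > 2 * (17 * \<delta>) + 2 * \<delta>" if "s \<in> letter ` K" for s
    using that K letter_long by auto
  show "dist y (act (letter k) y) - 18 * \<delta> \<le> gromov_prod (act (letter k) y) (act (letter k \<otimes> word us) y) y"
    using word_direction[OF S corner long imageI[OF k] us] by simp
  have "gromov_prod (ax m) (act (letter k) y) y \<le> 17 * \<delta>"
    using cross[of k m] delta_pos by (simp add: act_letter gromov_prod_commute)
  from word_transversal[OF S corner long imageI[OF k] us this]
  show "gromov_prod (ax m) (act (letter k \<otimes> word us) y) y \<le> 18 * \<delta>" by simp
qed

lemma letter_shift:
  assumes "letter k \<otimes> u = letter k' \<otimes> v" "u \<in> carrier G" "v \<in> carrier G"
  shows "u = \<gamma> [^] (e * (int k' - int k)) \<otimes> v"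
proof -
  have "\<gamma> [^] (e * int k) \<otimes> u = \<gamma> [^] (e * int k') \<otimes> v"
    using assms g gamma by (simp add: letter_def m_assoc)
  then have "\<gamma> [^] (- (e * int k)) \<otimes> (\<gamma> [^] (e * int k) \<otimes> u) = \<gamma> [^] (- (e * int k)) \<otimes> (\<gamma> [^] (e * int k') \<otimes> v)"
    by simp
  then show ?thesis using assms gamma
    by (simp add: m_assoc[symmetric] int_pow_mult[symmetric] algebra_simps)
qed

text \<open>Two words with different first letters and the same endpoint: then \<open>\<gamma>\<^sup>m\<close>, with \<open>m\<close> the
  difference of the exponents, cannot move \<open>y\<close> far, and it almost fixes \<open>g y\<close>.\<close>

lemma first_letters:
  assumes K: "\<And>k. k \<in> K \<Longrightarrow> real k * l > t + 17 * \<delta>" and k: "k \<in> K" "k' \<in> K" "k \<noteq> k'"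
    and us: "set us \<subseteq> letter ` K" "set vs \<subseteq> letter ` K" "length us = length vs"
    and eq: "letter k \<otimes> word us = letter k' \<otimes> word vs"
  defines "m \<equiv> e * (int k' - int k)"
  shows "real_of_int \<bar>m\<bar> * l \<le> 36 * \<delta>"
    and "real_of_int \<bar>m\<bar> * l \<le> \<delta> \<Longrightarrow> dist (act g y) (act (\<gamma> [^] m) (act g y)) \<le> 49 * \<delta>"
proof -
  have S: "letter ` K \<subseteq> carrier G" by auto
  have wc: "word us \<in> carrier G" "word vs \<in> carrier G" using us S by auto
  have shift: "word us = \<gamma> [^] m \<otimes> word vs"
    unfolding m_def by (rule letter_shift[OF eq wc])
  have "us \<noteq> []"
  proof
    assume "us = []"
    then have "\<gamma> [^] (0::int) = \<gamma> [^] m" using shift us gamma by simp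
    then have "m = 0" using ax_inj by simp
    then show False using k(3) e by (auto simp: m_def)
  qed
  then obtain k1 us' k2 vs' where 1: "us = letter k1 # us'" "vs = letter k2 # vs'" "k1 \<in> K" "k2 \<in> K"
    "set us' \<subseteq> letter ` K" "set vs' \<subseteq> letter ` K"
    using us by (cases us; cases vs) auto
  define q where "q = act (word us) y"
  have q2: "q = act (\<gamma> [^] m) (act (word vs) y)" using shift wc gamma by (simp add: q_def act_mult)
  \<comment> \<open>The endpoint \<open>q\<close> is transversal to the axis both at
    \<open>y\<close> and at \<open>ax m\<close>; the two products add up to the distance of these
    points.\<close>
  have "gromov_prod (ax m) q y \<le> 18 * \<delta>"
    using letters_words(2)[OF K 1(3) 1(5)] 1 by (simp add: q_def)
  moreover have "gromov_prod (ax (- m)) (act (word vs) y) y \<le> 18 * \<delta>"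
    using letters_words(2)[OF K 1(4) 1(6)] 1 by simp
  then have "gromov_prod y q (ax m) \<le> 18 * \<delta>"
    using act_gromov[of "\<gamma> [^] m" "ax (- m)" "act (word vs) y" y] gamma by (simp add: q2)
  ultimately show "real_of_int \<bar>m\<bar> * l \<le> 36 * \<delta>"
    using gromov_prod_add[of "ax m" q y] y_ax_dist(1)[of m] by (simp add: dist_commute)
  have toward: "t - 10 * \<delta> \<le> gromov_prod (act g y) (act (letter k \<otimes> word ws) y) y"
    if "k \<in> K" "set ws \<subseteq> letter ` K" for k ws
  proof -
    have "t - 9 * \<delta> \<le> gromov_prod (act g y) (act (letter k) y) y"
      using gromov_prod_add[of y "act (letter k) y" "act g y"] outward[of k]
      by (simp add: act_letter gromov_prod_commute)
    moreover have "t - 9 * \<delta> \<le> gromov_prod (act (letter k) y) (act (letter k \<otimes> word ws) y) y"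
      using letters_words(1)[OF K that] letter_dist(1)[of k] K[OF that(1)] far delta_pos by simp
    ultimately show ?thesis
      using gromov_prod_min[of "act g y" "act (letter k) y" y "act (letter k \<otimes> word ws) y"] by simp
  qed
  assume m: "real_of_int \<bar>m\<bar> * l \<le> \<delta>"
  let ?w = "act (\<gamma> [^] m) (act g y)"
  have close: "dist y (ax m) \<le> 9 * \<delta>" using y_ax_dist(2)[of m] m by simp
  have A: "t - 10 * \<delta> \<le> gromov_prod (act g y) q y"
    using toward[OF 1(3) 1(5)] 1 by (simp add: q_def)
  have "t - 10 * \<delta> \<le> gromov_prod (act g y) (act (word vs) y) y"
    using toward[OF 1(4) 1(6)] 1 by simp
  then have "t - 10 * \<delta> \<le> gromov_prod ?w q (ax m)"
    using act_gromov[of "\<gamma> [^] m" "act g y" "act (word vs) y" y] gamma by (simp add: q2)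
  then have B: "t - 19 * \<delta> \<le> gromov_prod q ?w y"
    using gromov_prod_perturb_base[of ?w q "ax m" y] close by (simp add: dist_commute gromov_prod_commute)
  \<comment> \<open>The 49 \<delta>: twice the loss of 20 \<delta> in this product, plus the 9
    \<delta> by which \<open>dist y ?w\<close> may exceed \<open>t\<close>.\<close>
  have "t - 20 * \<delta> \<le> gromov_prod (act g y) ?w y"
    using gromov_prod_min[of "act g y" q y ?w] A B delta_pos by simp
  moreover have "dist y ?w \<le> t + 9 * \<delta>"
    using dist_triangle[of y ?w "ax m"] close gamma act_dist[of "\<gamma> [^] m" y "act g y"] by simp
  ultimately show "dist (act g y) ?w \<le> 49 * \<delta>"
    by (simp add: gromov_prod_def)
qed

end

section \<open>Nearest orbit points and parallel axes\<close>

context axis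
begin

lemma multiple_above:
  assumes "0 \<le> c"
  obtains k :: nat where "c < real k * l" "real k * l \<le> c + l"
proof -
  define k where "k = nat \<lfloor>c / l\<rfloor> + 1"
  have "0 \<le> c / l" using assms l_pos by simp
  then have "c / l < real k" "real k \<le> c / l + 1" unfolding k_def by linarith+
  then have "c < real k * l" "real k * l \<le> (c / l + 1) * l"
    using l_pos by (simp_all add: pos_divide_less_eq)
  moreover have "(c / l + 1) * l = c + l" using l_pos by (simp add: distrib_right)
  ultimately show ?thesis using that by simp
qed

lemma nearest_exists:
  obtains k0 where "\<And>k. dist w (ax k0) \<le> dist w (ax k)"
proof -
  let ?S = "{k. dist w (ax k) \<le> dist w y}"
  have "?S \<subseteq> {- \<lceil>2 * dist w y / l\<rceil> .. \<lceil>2 * dist w y / l\<rceil>}"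
  proof
    fix k assume "k \<in> ?S"
    then have "real_of_int \<bar>k\<bar> * l \<le> 2 * dist w y"
      using y_ax_dist(1)[of k] dist_triangle[of y "ax k" w] by (simp add: dist_commute)
    then have "real_of_int \<bar>k\<bar> \<le> 2 * dist w y / l" using l_pos by (simp add: pos_le_divide_eq)
    then have "\<bar>k\<bar> \<le> \<lceil>2 * dist w y / l\<rceil>" by linarith
    then show "k \<in> {- \<lceil>2 * dist w y / l\<rceil> .. \<lceil>2 * dist w y / l\<rceil>}" by auto
  qed
  then have fin: "finite ?S" by (rule finite_subset) simp
  have "0 \<in> ?S" by simp
  then have ne: "?S \<noteq> {}" by blast
  define k0 where "k0 = arg_min_on (\<lambda>k. dist w (ax k)) ?S"
  have k0: "k0 \<in> ?S" "\<not> (\<exists>k\<in>?S. dist w (ax k) < dist w (ax k0))"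
    using arg_min_if_finite[OF fin ne, of "\<lambda>k. dist w (ax k)"] by (simp_all add: k0_def)
  have "dist w (ax k0) \<le> dist w (ax k)" for k
    using k0 by (cases "k \<in> ?S") (auto simp: not_less)
  then show ?thesis by (rule that)
qed

text \<open>A power of \<gamma> brings the orbit point nearest to \<open>act h y\<close> to
  \<open>y\<close>. The two half-axes at \<open>act g y\<close> part with product at most 8
  \<delta>, so \<open>y\<close> follows at most one of them beyond 9 \<delta>; \<open>e\<close>
  names a half that it does not follow.\<close>

lemma transversal_exists:
  assumes h: "h \<in> carrier G" and far: "\<And>k. 26 * \<delta> \<le> dist (act h y) (ax k)"
  obtains g e where "transversal G \<delta> act D \<gamma> y l g e" "\<And>k. dist y (act g y) \<le> dist (act h y) (ax k)"
proof -
  obtain k0 where k0: "\<And>k. dist (act h y) (ax k0) \<le> dist (act h y) (ax k)"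
    using nearest_exists by blast
  define g where "g = \<gamma> [^] (- k0) \<otimes> h"
  have g: "g \<in> carrier G" using h gamma by (simp add: g_def)
  have gd: "dist (act g y) (ax k) = dist (act h y) (ax (k + k0))" for k
    using act_dist[of "\<gamma> [^] (- k0)" "act h y" "ax (k + k0)"] h gamma by (simp add: g_def act_mult)
  have near: "dist (act g y) y \<le> dist (act g y) (ax k)" for k
    using gd[of 0] gd[of k] k0 by simp
  have far': "26 * \<delta> \<le> dist y (act g y)"
    using gd[of 0] far by (simp add: dist_commute)
  have "\<exists>e. (e = 1 \<or> e = -1) \<and> (\<forall>j::nat. gromov_prod (act g (ax (e * int j))) y (act g y) \<le> 9 * \<delta>)"
  proof (cases "\<forall>j::nat. gromov_prod (act g (ax (int j))) y (act g y) \<le> 9 * \<delta>")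
    case False
    then obtain j :: nat where j: "\<not> gromov_prod (act g (ax (int j))) y (act g y) \<le> 9 * \<delta>" by blast
    have "gromov_prod (act g (ax (- int i))) y (act g y) \<le> 9 * \<delta>" for i :: nat
    proof -
      have "gromov_prod (act g (ax (- int i))) (act g (ax (int j))) (act g y) \<le> 8 * \<delta>"
        using ax_between[of "- int i" 0 "int j"] g by simp
      from gromov_prod_split[OF this, of y] show ?thesis using j by (simp add: gromov_prod_commute)
    qed
    then show ?thesis by (intro exI[of _ "-1"]) simp
  qed (intro exI[of _ 1], simp)
  then obtain e where "transversal G \<delta> act D \<gamma> y l g e"
    using g near far' by (auto intro!: transversal.intro axis_axioms transversal_axioms.intro)
  moreover have "dist y (act g y) \<le> dist (act h y) (ax k)" for k
    using gd[of 0] k0 by (simp add: dist_commute)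
  ultimately show ?thesis by (rule that)
qed

text \<open>If \<open>h\<close> maps a half-axis into a bounded neighbourhood of the axis, pigeonholing the
  elements that carry \<open>h \<gamma>\<^sup>j y\<close> back near \<open>y\<close> shows that \<open>h\<close> commensurates the cyclic group of \<open>\<gamma>\<close>.\<close>

lemma parallel_commensurates:
  assumes h: "h \<in> carrier G" and par: "\<And>j::nat. \<exists>k. dist (act h (ax (int j))) (ax k) \<le> r"
  obtains i :: nat where "i > 0" "h \<otimes> h \<otimes> \<gamma> [^] i = \<gamma> [^] i \<otimes> (h \<otimes> h)"
proof -
  obtain \<phi> where \<phi>: "\<And>j::nat. dist (act h (ax (int j))) (ax (\<phi> j)) \<le> r" using par by metis
  define E where "E j = \<gamma> [^] (- \<phi> j) \<otimes> (h \<otimes> \<gamma> [^] int j)" for j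
  have Ec: "E j \<in> carrier G" for j using h gamma by (simp add: E_def)
  have "dist y (act (E j) y) \<le> r" for j
  proof -
    have "act (E j) y = act (\<gamma> [^] (- \<phi> j)) (act h (ax (int j)))"
      using h gamma by (simp add: E_def act_mult)
    moreover have "y = act (\<gamma> [^] (- \<phi> j)) (ax (\<phi> j))" by simp
    ultimately have "dist y (act (E j) y) = dist (ax (\<phi> j)) (act h (ax (int j)))"
      using gamma by (metis act_dist int_pow_closed)
    then show ?thesis using \<phi>[of j] by (simp add: dist_commute)
  qed
  then have "range E \<subseteq> {k \<in> carrier G. dist y (act k y) \<le> r}" using Ec by blast
  then have "finite (range E)" using finite_displacement finite_subset by blast
  then have "\<not> inj E" using finite_imageD infinite_UNIV_nat by blast
  then obtain j j' where jj: "j < j'" "E j = E j'"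
    by (auto simp: inj_def) (metis linorder_neqE_nat)
  define i where "i = j' - j"
  define i' where "i' = \<phi> j' - \<phi> j"
  have i: "i > 0" "int j' = int i + int j" using jj by (simp_all add: i_def)
  have "h \<otimes> \<gamma> [^] int j' = \<gamma> [^] \<phi> j' \<otimes> E j'"
    using h gamma by (simp add: E_def m_assoc[symmetric] int_pow_mult[symmetric])
  also have "\<dots> = \<gamma> [^] \<phi> j' \<otimes> E j" by (simp only: jj)
  also have "\<dots> = \<gamma> [^] i' \<otimes> h \<otimes> \<gamma> [^] int j"
    using h gamma by (simp add: E_def i'_def m_assoc[symmetric] int_pow_mult[symmetric])
  finally have "h \<otimes> \<gamma> [^] int i \<otimes> \<gamma> [^] int j = \<gamma> [^] i' \<otimes> h \<otimes> \<gamma> [^] int j"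
    using h gamma i(2) by (simp add: int_pow_mult m_assoc)
  then have conj: "h \<otimes> \<gamma> [^] int i = \<gamma> [^] i' \<otimes> h" using h gamma by simp
  have conjp: "h \<otimes> \<gamma> [^] (int i * int p) = \<gamma> [^] (i' * int p) \<otimes> h" for p :: nat
  proof (induction p)
    case (Suc p)
    have "h \<otimes> \<gamma> [^] (int i * int (Suc p)) = (h \<otimes> \<gamma> [^] int i) \<otimes> \<gamma> [^] (int i * int p)"
      using h gamma by (simp add: m_assoc int_pow_mult[symmetric] distrib_left)
    also have "\<dots> = \<gamma> [^] i' \<otimes> (h \<otimes> \<gamma> [^] (int i * int p))"
      using h gamma by (simp add: conj m_assoc)
    also have "\<dots> = \<gamma> [^] (i' * int (Suc p)) \<otimes> h"
      using h gamma by (simp add: Suc m_assoc[symmetric] int_pow_mult[symmetric] distrib_left)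
    finally show ?case .
  qed (use h in simp)
  define s where "s = dist y (act h y)"
  have len: "\<bar>dist y (ax (int i * int p)) - dist y (ax (i' * int p))\<bar> \<le> 2 * s" for p :: nat
  proof -
    have "act h (ax (int i * int p)) = act (\<gamma> [^] (i' * int p)) (act h y)"
      using h gamma conjp[of p] by (metis act_mult ax_def int_pow_closed)
    then have 1: "dist y (ax (int i * int p)) = dist (act h y) (act (\<gamma> [^] (i' * int p)) (act h y))"
      using h by (metis act_dist)
    have 2: "dist (ax (i' * int p)) (act (\<gamma> [^] (i' * int p)) (act h y)) = s"
      using gamma act_dist[of "\<gamma> [^] (i' * int p)" y "act h y"] by (simp add: s_def)
    show ?thesis
      using 1 2 dist_triangle[of "act h y" "act (\<gamma> [^] (i' * int p)) (act h y)" y]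
        dist_triangle[of y "act (\<gamma> [^] (i' * int p)) (act h y)" "ax (i' * int p)"]
        dist_triangle[of y "ax (i' * int p)" "act h y"]
        dist_triangle[of "act h y" "ax (i' * int p)" "act (\<gamma> [^] (i' * int p)) (act h y)"]
      by (simp add: s_def dist_commute abs_le_iff)
  qed
  \<comment> \<open>By \<open>len\<close> the conjugate powers have displacements at
    \<open>y\<close> within \<open>2 * s\<close> for every \<open>p\<close>; exponents of different
    size would let the gap grow like \<open>p * l\<close>.\<close>
  have "\<bar>i'\<bar> = int i"
  proof (rule ccontr)
    assume ne: "\<bar>i'\<bar> \<noteq> int i"
    obtain p :: nat where p: "real p > (8 * \<delta> + 2 * s) / l" using reals_Archimedean2 by blast
    have P: "real p * l > 8 * \<delta> + 2 * s" using p l_pos by (simp add: pos_divide_less_eq)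
    define x z where "x = real_of_int \<bar>i'\<bar>" and "z = real i"
    have xz: "x + 1 \<le> z \<or> z + 1 \<le> x" using ne unfolding x_def z_def by linarith
    have "real_of_int \<bar>i' * int p\<bar> * l = x * (real p * l)" "real_of_int \<bar>int i * int p\<bar> * l = z * (real p * l)"
      by (simp_all add: x_def z_def abs_mult)
    then have "x * (real p * l) \<le> z * (real p * l) + 8 * \<delta> + 2 * s" "z * (real p * l) \<le> x * (real p * l) + 8 * \<delta> + 2 * s"
      using y_ax_dist[of "i' * int p"] y_ax_dist[of "int i * int p"] len[of p] by linarith+
    moreover have "0 < real p * l" using P delta_pos zero_le_dist[of y "act h y"] unfolding s_def by linarith
    then have "x + 1 \<le> z \<Longrightarrow> (x + 1) * (real p * l) \<le> z * (real p * l)" "z + 1 \<le> x \<Longrightarrow> (z + 1) * (real p * l) \<le> x * (real p * l)"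
      by (simp_all add: mult_right_mono)
    ultimately show False using xz P by (auto simp: distrib_right)
  qed
  \<comment> \<open>\<open>h\<close> may reverse the axis, which is the case of
    \<open>i' = - int i\<close>; applying it twice restores the sign, hence
    \<open>h \<otimes> h\<close> in the conclusion.\<close>
  then have "i' = int i \<or> i' = - int i" by auto
  then have comm: "h \<otimes> \<gamma> [^] i' = \<gamma> [^] int i \<otimes> h"
  proof
    assume i': "i' = - int i"
    have "\<gamma> [^] int i \<otimes> (h \<otimes> \<gamma> [^] int i) \<otimes> \<gamma> [^] (- int i) = \<gamma> [^] int i \<otimes> (\<gamma> [^] (- int i) \<otimes> h) \<otimes> \<gamma> [^] (- int i)"
      by (simp only: conj i')
    moreover have "\<gamma> [^] int i \<otimes> (h \<otimes> \<gamma> [^] int i) \<otimes> \<gamma> [^] (- int i) = \<gamma> [^] int i \<otimes> h \<otimes> (\<gamma> [^] int i \<otimes> \<gamma> [^] (- int i))"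
      using h gamma by (simp add: m_assoc)
    moreover have "\<gamma> [^] int i \<otimes> (\<gamma> [^] (- int i) \<otimes> h) \<otimes> \<gamma> [^] (- int i) = (\<gamma> [^] int i \<otimes> \<gamma> [^] (- int i)) \<otimes> h \<otimes> \<gamma> [^] (- int i)"
      using h gamma by (simp add: m_assoc)
    moreover have "\<gamma> [^] int i \<otimes> \<gamma> [^] (- int i) = \<one>" using gamma int_pow_mult[OF gamma, of "int i" "- int i"] by simp
    ultimately show ?thesis using h gamma i' by simp
  qed (use conj in simp)
  have "h \<otimes> h \<otimes> \<gamma> [^] int i = h \<otimes> (\<gamma> [^] i' \<otimes> h)" using h gamma by (simp add: m_assoc conj)
  also have "\<dots> = \<gamma> [^] int i \<otimes> (h \<otimes> h)" using h gamma comm by (simp add: m_assoc[symmetric])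
  finally have "h \<otimes> h \<otimes> \<gamma> [^] i = \<gamma> [^] i \<otimes> (h \<otimes> h)" by (simp only: int_pow_int)
  then show ?thesis using that i by blast
qed

end

section \<open>Transversal axes are not parallel, and their letters generate free semigroups\<close>

context transversal
begin

lemma conj_power:
  "(inv g \<otimes> \<gamma> [^] (m::int) \<otimes> g) [^] (p::nat) = inv g \<otimes> \<gamma> [^] (m * int p) \<otimes> g"
proof (induction p)
  case (Suc p)
  have "g \<otimes> (inv g \<otimes> (\<gamma> [^] m \<otimes> g)) = \<gamma> [^] m \<otimes> g"
    using g gamma by (simp add: m_assoc[symmetric])
  then have "(inv g \<otimes> \<gamma> [^] m \<otimes> g) [^] Suc p = inv g \<otimes> \<gamma> [^] (m * int p) \<otimes> (g \<otimes> inv g) \<otimes> \<gamma> [^] m \<otimes> g"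
    using g gamma Suc by (simp add: m_assoc)
  also have "\<dots> = inv g \<otimes> (\<gamma> [^] (m * int p) \<otimes> \<gamma> [^] m) \<otimes> g"
    using g gamma by (simp add: m_assoc)
  finally show ?case using gamma by (simp add: int_pow_mult[symmetric] distrib_left add.commute)
qed (use g in simp)

text \<open>Otherwise some power of \<open>\<gamma>\<close> would commute with a power of \<open>g \<gamma> g\<^sup>-\<^sup>1\<close> and so move all points
  of the orbit of that power by the same amount, although this orbit runs away from the axis.\<close>

lemma not_parallel:
  fixes m :: int
  assumes m: "m \<noteq> 0" and par: "\<And>j::nat. \<exists>k. dist (act (inv g \<otimes> \<gamma> [^] m \<otimes> g) (ax (int j))) (ax k) \<le> r"
  shows False
proof -
  define h where "h = inv g \<otimes> \<gamma> [^] m \<otimes> g"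
  have h: "h \<in> carrier G" using g gamma by (simp add: h_def)
  obtain i :: nat where i: "i > 0" "h \<otimes> h \<otimes> \<gamma> [^] i = \<gamma> [^] i \<otimes> (h \<otimes> h)"
    using parallel_commensurates[OF h] par unfolding h_def by blast
  define h2 where "h2 = h \<otimes> h"
  have h2: "h2 \<in> carrier G" using h by (simp add: h2_def)
  \<comment> \<open>The sign \<open>e\<close> makes the \<open>g\<close>-translate of the orbit of
    \<open>c\<close> run along the outward half, where \<open>cross\<close> applies.\<close>
  define c where "c = \<gamma> [^] (e * int i)"
  have c: "c \<in> carrier G" using gamma by (simp add: c_def)
  have comm_i: "h2 \<otimes> \<gamma> [^] int i = \<gamma> [^] int i \<otimes> h2" using i by (simp add: h2_def int_pow_int)
  have comm: "h2 \<otimes> c = c \<otimes> h2"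
    using e
  proof
    assume "e = -1"
    then have ci: "c = inv (\<gamma> [^] int i)" using gamma by (simp add: c_def int_pow_neg)
    have "c \<otimes> (h2 \<otimes> \<gamma> [^] int i) \<otimes> c = c \<otimes> (\<gamma> [^] int i \<otimes> h2) \<otimes> c" by (simp only: comm_i)
    moreover have "c \<otimes> (h2 \<otimes> \<gamma> [^] int i) \<otimes> c = c \<otimes> h2 \<otimes> (\<gamma> [^] int i \<otimes> c)"
      using h2 c gamma by (simp add: m_assoc)
    moreover have "c \<otimes> (\<gamma> [^] int i \<otimes> h2) \<otimes> c = (c \<otimes> \<gamma> [^] int i) \<otimes> h2 \<otimes> c"
      using h2 c gamma by (simp add: m_assoc)
    moreover have "c \<otimes> \<gamma> [^] int i = \<one>" "\<gamma> [^] int i \<otimes> c = \<one>" using gamma by (simp_all add: ci)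
    ultimately show ?thesis using h2 c by simp
  qed (use comm_i in \<open>simp add: c_def\<close>)
  \<comment> \<open>33 = 16 + 17: after the 16 \<delta> of \<open>cross\<close>, more than 17
    \<delta> of the way from \<open>y\<close> to \<open>ax M\<close> must remain.\<close>
  obtain p :: nat where p: "33 * \<delta> < real p * l" using multiple_above[of "33 * \<delta>"] delta_pos by auto
  define M where "M = m * 2 * int p"
  have "h2 = h [^] (2::nat)" using h by (simp add: h2_def numeral_2_eq_2)
  then have "h2 [^] p = h [^] (2 * p)" using h by (simp add: nat_pow_pow)
  then have h2p: "h2 [^] p = inv g \<otimes> \<gamma> [^] M \<otimes> g" by (simp add: h_def conj_power M_def mult.assoc)
  have "1 \<le> \<bar>m * 2\<bar>" using m by linarith
  then have "1 \<le> real_of_int \<bar>m * 2\<bar>" by linarith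
  then have "1 * real p \<le> real_of_int \<bar>m * 2\<bar> * real p" by (intro mult_right_mono) auto
  also have "\<dots> = real_of_int \<bar>M\<bar>" by (simp add: M_def abs_mult)
  finally have "real p \<le> real_of_int \<bar>M\<bar>" by simp
  then have "real p * l \<le> real_of_int \<bar>M\<bar> * l" using l_pos by (intro mult_right_mono) auto
  with p have Ml: "33 * \<delta> < real_of_int \<bar>M\<bar> * l" by (rule less_le_trans)
  define H where "H = dist y (act (h2 [^] p) y)"
  define q where "q j = act g (ax (e * int (i * j)))" for j :: nat
  have cj: "act (c [^] j) y = ax (e * int (i * j))" for j :: nat
    using gamma int_pow_pow[OF gamma, of "e * int i" "int j"]
    by (simp add: c_def int_pow_int[symmetric] mult.assoc)
  have moved: "dist (q j) (act (\<gamma> [^] M) (q j)) = H" for j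
  proof -
    have "act (\<gamma> [^] M) (q j) = act g (act (h2 [^] p) (act (c [^] j) y))"
      using g gamma by (simp add: q_def h2p act_mult cj)
    also have "\<dots> = act g (act (c [^] j) (act (h2 [^] p) y))"
      by (simp only: act_power_commute[OF h2 c comm])
    finally have "dist (q j) (act (\<gamma> [^] M) (q j)) = dist (act g (act (c [^] j) y)) (act g (act (c [^] j) (act (h2 [^] p) y)))"
      by (simp only: q_def cj)
    also have "\<dots> = H" unfolding H_def using g c by (simp only: act_dist nat_pow_closed)
    finally show ?thesis .
  qed
  \<comment> \<open>\<open>q j\<close> and its image \<open>?q'\<close> leave the long segment from
    \<open>y\<close> to \<open>?b\<close> transversally at its two ends, so the path from
    \<open>q j\<close> over \<open>?b\<close> to \<open>?q'\<close> wastes at most 34 \<delta>,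
    while its ends are \<open>H\<close> apart.\<close>
  have bound: "dist y (q j) \<le> H + 34 * \<delta>" for j
  proof -
    let ?b = "ax M" and ?q' = "act (\<gamma> [^] M) (q j)"
    have 1: "gromov_prod (q j) ?b y \<le> 16 * \<delta>" unfolding q_def by (rule cross)
    have "gromov_prod (q j) (ax (- M)) y \<le> 16 * \<delta>" unfolding q_def by (rule cross)
    then have "gromov_prod y ?q' ?b \<le> 16 * \<delta>"
      using act_gromov[of "\<gamma> [^] M" "q j" "ax (- M)" y] gamma by (simp add: gromov_prod_commute)
    moreover have "17 * \<delta> < gromov_prod y (q j) ?b"
      using gromov_prod_add[of ?b "q j" y] 1 y_ax_dist(1)[of M] Ml by (simp add: gromov_prod_commute dist_commute)
    ultimately have "gromov_prod (q j) ?q' ?b \<le> 17 * \<delta>"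
      using gromov_prod_split[of y ?q' ?b "16 * \<delta>" "q j"] by auto
    moreover have "dist ?b ?q' = dist y (q j)"
      using gamma act_dist[of "\<gamma> [^] M" y "q j"] by simp
    ultimately have "dist ?b (q j) + dist y (q j) - H \<le> 34 * \<delta>"
      using moved[of j] by (simp add: gromov_prod_def)
    then show ?thesis using zero_le_dist[of ?b "q j"] by linarith
  qed
  obtain j :: nat where j: "H + 34 * \<delta> + t < real j * l"
    using multiple_above[of "H + 34 * \<delta> + t"] delta_pos zero_le_dist by (auto simp: H_def)
  have "j \<le> i * j" using i(1) by simp
  then have "real j * l \<le> real (i * j) * l" using l_pos by (intro mult_right_mono of_nat_mono) auto
  also have "\<dots> \<le> dist y (ax (e * int (i * j)))" using y_ax_dist(1)[of "e * int (i * j)"] by simp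
  also have "\<dots> = dist (act g y) (q j)" using g by (simp add: q_def)
  also have "\<dots> \<le> t + dist y (q j)" using dist_triangle[of "act g y" "q j" y] by (simp add: dist_commute)
  finally show False using bound[of j] j by simp
qed

lemma letter_inj: "letter k = letter k' \<Longrightarrow> k = k'"
  using letter_shift[of k \<one> k' \<one>] gamma e ax_inj[of 0 "e * (int k' - int k)"] by auto

text \<open>The alternatives in \<open>sep\<close> contradict the two conclusions of
  \<open>first_letters\<close>, so equal words of equal length have equal first letters and
  \<open>entropy_gt\<close> applies.\<close>

lemma entropy_letters:
  assumes K: "\<And>k. k \<in> K \<Longrightarrow> real k * l > t + 17 * \<delta>" and fin: "finite K" "K \<noteq> {}"
    and disp: "\<And>k. k \<in> K \<Longrightarrow> t + real k * l + 8 * \<delta> \<le> L" "L > 0"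
    and sep: "\<And>k k'. k \<in> K \<Longrightarrow> k' \<in> K \<Longrightarrow> k \<noteq> k' \<Longrightarrow>
      36 * \<delta> < real_of_int \<bar>e * (int k' - int k)\<bar> * l \<or>
      real_of_int \<bar>e * (int k' - int k)\<bar> * l \<le> \<delta> \<and>
      49 * \<delta> < dist (act g y) (act (\<gamma> [^] (e * (int k' - int k))) (act g y))"
    and c: "0 \<le> c" "c < ln (card K) / L"
  shows "entropy G act x > ereal c"
proof (rule entropy_gt[of "letter ` K" y L])
  show "c < ln (real (card (letter ` K))) / L"
    using c letter_inj by (subst card_image) (auto simp: inj_on_def)
  show "dist y (act s y) \<le> L" if "s \<in> letter ` K" for s
    using that letter_dist(2) disp(1) by (auto intro: order_trans)
  fix s s' us vs
  assume s: "s \<in> letter ` K" "s' \<in> letter ` K" and us: "set us \<subseteq> letter ` K" "set vs \<subseteq> letter ` K"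
    "length us = length vs" and eq: "s \<otimes> word us = s' \<otimes> word vs"
  obtain k k' where k: "s = letter k" "s' = letter k'" "k \<in> K" "k' \<in> K" using s by auto
  show "s = s'"
  proof (rule ccontr)
    assume "s \<noteq> s'"
    then have "k \<noteq> k'" using k by auto
    from first_letters[OF K k(3,4) this us] sep[OF k(3,4) this] eq k
    show False by force
  qed
qed (use fin disp c in auto)

text \<open>Two letters suffice, with exponents just over 36 \<delta> apart in length. The longer
  one has displacement at most 58 + 76 + 37 + 8 = 179 times \<delta>, and \<open>ln 2 / 180\<close>
  exceeds 1/750.\<close>

lemma entropy_close:
  assumes "t \<le> 58 * \<delta>"
  shows "entropy G act x > ereal (1 / (750 * \<delta>))"
proof -
  obtain k1 :: nat where k1: "t + 17 * \<delta> < real k1 * l" "real k1 * l \<le> t + 17 * \<delta> + l"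
    using multiple_above[of "t + 17 * \<delta>"] delta_pos by auto
  obtain m :: nat where m: "36 * \<delta> < real m * l" "real m * l \<le> 36 * \<delta> + l"
    using multiple_above[of "36 * \<delta>"] delta_pos by auto
  have m0: "m \<noteq> 0" using m delta_pos by (intro notI) simp
  have k2: "real (k1 + m) * l = real k1 * l + real m * l" by (simp add: distrib_right)
  show ?thesis
  proof (rule entropy_letters[of "{k1, k1 + m}" "180 * \<delta>"])
    have "1 / (750 * \<delta>) < (2 / 3) / (180 * \<delta>)" using delta_pos by (simp add: field_simps)
    also have "\<dots> \<le> ln 2 / (180 * \<delta>)" using ln2_ge_two_thirds delta_pos by (intro divide_right_mono) auto
    finally show "1 / (750 * \<delta>) < ln (real (card {k1, k1 + m})) / (180 * \<delta>)" using m0 by simp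
    fix k assume "k \<in> {k1, k1 + m}"
    then show "t + 17 * \<delta> < real k * l" "t + real k * l + 8 * \<delta> \<le> 180 * \<delta>"
      using k1 m k2 l_le assms delta_pos by auto
  next
    fix k k' assume "k \<in> {k1, k1 + m}" "k' \<in> {k1, k1 + m}" "k \<noteq> k'"
    then have "\<bar>e * (int k' - int k)\<bar> = int m" by auto
    then show "36 * \<delta> < real_of_int \<bar>e * (int k' - int k)\<bar> * l \<or>
      real_of_int \<bar>e * (int k' - int k)\<bar> * l \<le> \<delta> \<and>
      49 * \<delta> < dist (act g y) (act (\<gamma> [^] (e * (int k' - int k))) (act g y))"
      using m by simp
  qed (use delta_pos in auto)
qed

text \<open>The exponents are consecutive and span at most \<delta>, the second case of
  \<open>first_letters\<close>. A displacement is at most \<open>t\<close> to cross,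
  \<open>t + 17 * \<delta> + l\<close> along the axis, \<delta> for the span and 8 \<delta> of
  error.\<close>

lemma entropy_many_letters:
  assumes N: "real N * l \<le> \<delta>"
    and sep: "\<And>m::int. m \<noteq> 0 \<Longrightarrow> 49 * \<delta> < dist (act g y) (act (\<gamma> [^] m) (act g y))"
    and c: "0 \<le> c" "c < ln N / (2 * t + 27 * \<delta>)"
  shows "entropy G act x > ereal c"
proof -
  have N0: "N \<noteq> 0" using c by (intro notI) simp
  obtain k1 :: nat where k1: "t + 17 * \<delta> < real k1 * l" "real k1 * l \<le> t + 17 * \<delta> + l"
    using multiple_above[of "t + 17 * \<delta>"] delta_pos by auto
  show ?thesis
  proof (rule entropy_letters[of "{k1..<k1 + N}" "2 * t + 27 * \<delta>"])
    fix k assume k: "k \<in> {k1..<k1 + N}"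
    have "real k1 * l \<le> real k * l" using k l_pos by (intro mult_right_mono) auto
    then show "t + 17 * \<delta> < real k * l" using k1 by linarith
    have "real k * l \<le> real (k1 + N) * l" using k l_pos by (intro mult_right_mono) auto
    then show "t + real k * l + 8 * \<delta> \<le> 2 * t + 27 * \<delta>"
      using k1 N l_le by (simp add: distrib_right)
  next
    fix k k' assume k: "k \<in> {k1..<k1 + N}" "k' \<in> {k1..<k1 + N}" "k \<noteq> k'"
    then have "\<bar>e * (int k' - int k)\<bar> \<le> int N" by auto
    then have "real_of_int \<bar>e * (int k' - int k)\<bar> \<le> real N" by linarith
    then have "real_of_int \<bar>e * (int k' - int k)\<bar> * l \<le> real N * l" using l_pos by (intro mult_right_mono) auto
    from order_trans[OF this N] have a: "real_of_int \<bar>e * (int k' - int k)\<bar> * l \<le> \<delta>" .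
    have b: "e * (int k' - int k) \<noteq> 0" using k e by auto
    show "36 * \<delta> < real_of_int \<bar>e * (int k' - int k)\<bar> * l \<or>
      real_of_int \<bar>e * (int k' - int k)\<bar> * l \<le> \<delta> \<and>
      49 * \<delta> < dist (act g y) (act (\<gamma> [^] (e * (int k' - int k))) (act g y))"
      by (intro disjI2 conjI a sep b)
  qed (use delta_pos c N0 in \<open>auto simp: add_nonneg_pos\<close>)
qed

end

section \<open>Short quasi-axes force large entropy\<close>

text \<open>\<open>N\<close> counts the steps of length \<open>l\<close> that fit into \<delta>.
  Trading the factor \<open>M0\<close> for \<open>29 * exp (M0 / 29)\<close> turns the exponent 4/29
  into 3/29, so \<open>ln N\<close> is at least \<open>M0 / 10\<close>, and the two bounds on
  \<open>M0\<close> control the terms in \<open>D\<close> and \<delta>.\<close>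

lemma orbit_count_exponent:
  fixes \<delta> D l M0 :: real
  assumes pos: "0 < \<delta>" "0 \<le> D" "0 < l"
    and M0: "720 \<le> M0" "20 * (D / \<delta> + 2) \<le> M0"
    and l: "l \<le> 3 powr (-34) * \<delta> * M0 * exp (-(4/29) * M0)"
  obtains N :: nat where "real N * l \<le> \<delta>" "1 / (750 * \<delta>) < ln N / (4 * D + 83 * \<delta>)" "l \<le> \<delta>"
proof -
  define X where "X = exp (3 / 29 * M0)"
  have X1: "1 \<le> X" using M0 by (simp add: X_def)
  have "M0 / 29 \<le> exp (M0 / 29)" using exp_ge_add_one_self[of "M0 / 29"] by linarith
  then have "M0 * exp (-(4/29) * M0) \<le> 29 * exp (M0 / 29) * exp (-(4/29) * M0)"
    by (intro mult_right_mono) auto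
  also have "\<dots> = 29 * (exp (M0 / 29) * exp (-(4/29) * M0))" by (simp only: mult.assoc)
  also have "exp (M0 / 29) * exp (-(4/29) * M0) = exp (- (3 / 29 * M0))"
    unfolding exp_add[symmetric] by (rule arg_cong[of _ _ exp]) (simp add: field_simps)
  also have "\<dots> = 1 / X" by (simp add: X_def exp_minus inverse_eq_divide)
  finally have 1: "M0 * exp (-(4/29) * M0) \<le> 29 / X" by simp
  have "(3::real) powr (-4) = inverse (3 powr 4)" by (rule powr_minus)
  also have "(3::real) powr 4 = 81" using powr_realpow[of "3::real" 4] by simp
  finally have "(3::real) powr (-4) = 1 / 81" by simp
  moreover have "(3::real) powr (-34) \<le> 3 powr (-4)" by (rule powr_mono) simp_all
  ultimately have 2: "(3::real) powr (-34) \<le> 1 / 81" by (simp only:)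
  have "l \<le> (3 powr (-34) * \<delta>) * (M0 * exp (-(4/29) * M0))" using l by (simp only: mult.assoc)
  also have "\<dots> \<le> (1 / 81 * \<delta>) * (29 / X)"
    using 1 2 pos M0 by (intro mult_mono) auto
  also have "\<dots> \<le> \<delta> / (2 * X)" using pos X1 by (simp add: field_simps)
  finally have lX: "l \<le> \<delta> / (2 * X)" .
  then have lX': "2 * X * l \<le> \<delta>" using X1 by (simp add: pos_le_divide_eq mult.commute)
  have "1 * l \<le> 2 * X * l" using X1 pos by (intro mult_right_mono) auto
  then have l_le: "l \<le> \<delta>" using lX' by simp
  define N where "N = nat \<lfloor>\<delta> / l\<rfloor>"
  \<comment> \<open>The factor 2 pays for rounding down, as \<open>X\<close> is at least 1.\<close>
  have "2 * X \<le> \<delta> / l" using lX' pos by (simp add: pos_le_divide_eq)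
  then have N: "real N \<le> \<delta> / l" "X \<le> real N" using X1 unfolding N_def by linarith+
  have "real N * l \<le> \<delta>" using N(1) pos by (simp add: pos_le_divide_eq)
  moreover have "1 / (750 * \<delta>) < ln N / (4 * D + 83 * \<delta>)"
  proof -
    have "ln X \<le> ln N" using N(2) X1 by (intro ln_mono) auto
    then have "3 / 29 * M0 \<le> ln N" by (simp add: X_def)
    then have lnN: "M0 / 10 \<le> ln N" using M0 by linarith
    have "20 * D + 40 * \<delta> \<le> M0 * \<delta>"
      using mult_right_mono[OF M0(2), of \<delta>] pos by (simp add: algebra_simps)
    moreover have "720 * \<delta> \<le> M0 * \<delta>" using M0 pos by (intro mult_right_mono) auto
    ultimately have "4 * D + 83 * \<delta> < 750 * (M0 / 10 * \<delta>)" using pos by simp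
    also have "M0 / 10 * \<delta> \<le> ln N * \<delta>" using lnN pos by (intro mult_right_mono) auto
    finally have "4 * D + 83 * \<delta> < ln N * (750 * \<delta>)" by simp
    then show ?thesis using pos by (simp add: field_simps add_nonneg_pos)
  qed
  ultimately show ?thesis using l_le by (rule that)
qed

context hyp_action
begin

text \<open>Changing the base point alters every displacement by at most
  \<open>2 * dist x y\<close>, which vanishes after division by \<open>k\<close>.\<close>

lemma transl_len_eq:
  assumes gamma: "\<gamma> \<in> carrier G"
    and low: "\<And>k::nat. real k * l \<le> dist y (act (\<gamma> [^] k) y)"
    and up: "\<And>k::nat. dist y (act (\<gamma> [^] k) y) \<le> real k * l + 8 * \<delta>"
  shows "transl_len G act x \<gamma> = l"
proof -
  define C where "C = 2 * dist x y + 8 * \<delta>"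
  have bound: "norm (dist x (act (\<gamma> [^] k) x) / real k - l) \<le> C / real k" if "k > 0" for k :: nat
  proof -
    have "\<bar>dist x (act (\<gamma> [^] k) x) - real k * l\<bar> \<le> C"
      using low[of k] up[of k] gamma delta_pos act_dist[of "\<gamma> [^] k" x y]
        dist_triangle[of x "act (\<gamma> [^] k) x" y] dist_triangle[of y "act (\<gamma> [^] k) x" "act (\<gamma> [^] k) y"]
        dist_triangle[of y "act (\<gamma> [^] k) y" x] dist_triangle[of x "act (\<gamma> [^] k) y" "act (\<gamma> [^] k) x"]
      by (simp add: C_def dist_commute abs_le_iff)
    moreover have "dist x (act (\<gamma> [^] k) x) / real k - l = (dist x (act (\<gamma> [^] k) x) - real k * l) / real k"
      using that by (simp add: field_simps)
    ultimately show ?thesis using that by (simp add: divide_right_mono)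
  qed
  have "(\<lambda>k. dist x (act (\<gamma> [^] k) x) / real k - l) \<longlonglongrightarrow> 0"
  proof (rule Lim_null_comparison)
    show "(\<lambda>k. C / real k) \<longlonglongrightarrow> 0" by (rule lim_const_over_n)
    show "eventually (\<lambda>k. norm (dist x (act (\<gamma> [^] k) x) / real k - l) \<le> C / real k) sequentially"
      using eventually_gt_at_top[of 0] by eventually_elim (rule bound)
  qed
  then have "(\<lambda>k. dist x (act (\<gamma> [^] k) x) / real k) \<longlonglongrightarrow> l" by (simp add: LIM_zero_iff)
  then show ?thesis unfolding transl_len_def by (rule limI)
qed

end

section \<open>Escaping from the axis, and the final count\<close>

context axis
begin

lemma same_side:
  assumes "e = 1 \<or> e = -1" "0 \<le> e * i" "0 \<le> e * j" "L \<le> real_of_int (e * i) * l" "L \<le> real_of_int (e * j) * l"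
  shows "L - 4 * \<delta> \<le> gromov_prod (ax i) (ax j) y"
proof -
  have ij: "\<bar>i\<bar> = e * i" "\<bar>j\<bar> = e * j" "\<bar>i - j\<bar> = \<bar>e * i - e * j\<bar>" using assms(1-3) by auto
  define I J where "I = real_of_int (e * i) * l" and "J = real_of_int (e * j) * l"
  have "real_of_int \<bar>e * i - e * j\<bar> * l = \<bar>I - J\<bar>"
    using l_pos by (simp add: I_def J_def left_diff_distrib[symmetric] abs_mult)
  then have "dist (ax i) (ax j) \<le> \<bar>I - J\<bar> + 8 * \<delta>" using ax_dist(2)[of i j] by (simp only: ij)
  moreover have "I \<le> dist y (ax i)" "J \<le> dist y (ax j)"
    using y_ax_dist(1)[of i] y_ax_dist(1)[of j] by (simp_all only: ij I_def J_def)
  moreover have "L \<le> I" "L \<le> J" using assms by (simp_all add: I_def J_def)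
  ultimately have "2 * L - 8 * \<delta> \<le> dist y (ax i) + dist y (ax j) - dist (ax i) (ax j)"
    by (cases "I \<le> J") auto
  then show ?thesis by (simp add: gromov_prod_def)
qed

text \<open>An orbit quasi-geodesic has only two ends, so it is not coarsely dense.\<close>

lemma far_point:
  assumes "non_elementary TYPE('a)"
  obtains z where "\<And>k. R \<le> dist z (ax k)"
proof -
  have "\<exists>z. \<forall>k. R \<le> dist z (ax k)"
  proof (rule ccontr)
    assume "\<not> ?thesis"
    then have "\<forall>z. \<exists>k. dist z (ax k) < R" by (auto simp: not_le)
    then obtain \<kappa> where \<kappa>: "\<And>z. dist z (ax (\<kappa> z)) < R" by metis
    obtain b :: 'a and u v w where conv: "conv_at_infinity b u" "conv_at_infinity b v" "conv_at_infinity b w"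
      and diff: "\<not> bdry_equiv b u v" "\<not> bdry_equiv b v w" "\<not> bdry_equiv b u w"
      using assms unfolding non_elementary_def by blast
    define C where "C = 2 * R + dist b y"
    have push: "gromov_prod z z' b \<le> gromov_prod (ax (\<kappa> z)) (ax (\<kappa> z')) y + C" for z z'
      using gromov_prod_perturb_base[of z z' b y] gromov_prod_perturb_point[of z z' y "ax (\<kappa> z)"]
        gromov_prod_perturb_point[of z' "ax (\<kappa> z)" y "ax (\<kappa> z')"] \<kappa>[of z] \<kappa>[of z']
      by (simp add: C_def gromov_prod_commute)
    have pull: "gromov_prod (ax (\<kappa> z)) (ax (\<kappa> z')) y \<le> gromov_prod z z' b + C" for z z'
      using gromov_prod_perturb_base[of "ax (\<kappa> z)" "ax (\<kappa> z')" y b] gromov_prod_perturb_point[of "ax (\<kappa> z)" "ax (\<kappa> z')" b z]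
        gromov_prod_perturb_point[of "ax (\<kappa> z')" z b z'] \<kappa>[of z] \<kappa>[of z']
      by (simp add: C_def gromov_prod_commute dist_commute)
    define ends where "ends e s \<longleftrightarrow> (\<forall>L. \<exists>N. \<forall>n\<ge>N. 0 \<le> e * \<kappa> (s n) \<and> L \<le> real_of_int (e * \<kappa> (s n)) * l)"
      for e and s :: "nat \<Rightarrow> 'a"
    have end_exists: "\<exists>e. (e = 1 \<or> e = -1) \<and> ends e s" if s: "conv_at_infinity b s" for s
    proof -
      obtain N0 where N0: "\<And>m n. N0 \<le> m \<Longrightarrow> N0 \<le> n \<Longrightarrow> 8 * \<delta> + C + 1 \<le> gromov_prod (s m) (s n) b"
        using s unfolding conv_at_infinity_def by blast
      \<comment> \<open>Late terms on opposite sides would have \<open>y\<close> between their orbit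
        points, hence product at most 8 \<delta> there.\<close>
      have no_cross: "\<not> (\<kappa> (s m) \<le> 0 \<and> 0 \<le> \<kappa> (s n))" if "N0 \<le> m" "N0 \<le> n" for m n
        using ax_between[of "\<kappa> (s m)" 0 "\<kappa> (s n)"] N0[OF that] push[of "s m" "s n"] by auto
      define e :: int where "e = (if 0 \<le> \<kappa> (s N0) then 1 else -1)"
      have sign: "0 \<le> e * \<kappa> (s n)" if "N0 \<le> n" for n
        using no_cross[OF that, of N0] no_cross[OF _ that, of N0] by (auto simp: e_def)
      have abs_e: "\<bar>\<kappa> (s n)\<bar> = e * \<kappa> (s n)" if "N0 \<le> n" for n
        using sign[OF that] by (auto simp: e_def split: if_splits)
      have "ends e s" unfolding ends_def
      proof
        fix L
        obtain N1 where N1: "\<And>m n. N1 \<le> m \<Longrightarrow> N1 \<le> n \<Longrightarrow> L + 8 * \<delta> + C \<le> gromov_prod (s m) (s n) b"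
          using s unfolding conv_at_infinity_def by blast
        have "L \<le> real_of_int (e * \<kappa> (s n)) * l" if n: "max N0 N1 \<le> n" for n
        proof -
          have "L + 8 * \<delta> + C \<le> gromov_prod (s n) (s n) b" using N1 n by simp
          also have "\<dots> \<le> dist y (ax (\<kappa> (s n))) + C"
            using push[of "s n" "s n"] by (simp add: gromov_prod_def)
          also have "\<dots> \<le> real_of_int (e * \<kappa> (s n)) * l + 8 * \<delta> + C"
            using y_ax_dist(2)[of "\<kappa> (s n)"] abs_e[of n] n by simp
          finally show ?thesis by simp
        qed
        then show "\<exists>N. \<forall>n\<ge>N. 0 \<le> e * \<kappa> (s n) \<and> L \<le> real_of_int (e * \<kappa> (s n)) * l"
          using sign by (intro exI[of _ "max N0 N1"]) auto
      qed
      moreover have "e = 1 \<or> e = -1" by (simp add: e_def)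
      ultimately show ?thesis by blast
    qed
    have same_end: "bdry_equiv b s s'" if e: "e = 1 \<or> e = -1" and s: "ends e s" "ends e s'" for e s s'
      unfolding bdry_equiv_def
    proof
      fix K
      obtain N where N: "\<And>n. N \<le> n \<Longrightarrow> 0 \<le> e * \<kappa> (s n) \<and> K + C + 4 * \<delta> \<le> real_of_int (e * \<kappa> (s n)) * l"
        using s(1) unfolding ends_def by blast
      obtain N' where N': "\<And>n. N' \<le> n \<Longrightarrow> 0 \<le> e * \<kappa> (s' n) \<and> K + C + 4 * \<delta> \<le> real_of_int (e * \<kappa> (s' n)) * l"
        using s(2) unfolding ends_def by blast
      have "K \<le> gromov_prod (s m) (s' n) b" if "max N N' \<le> m" "max N N' \<le> n" for m n
        using same_side[OF e, of "\<kappa> (s m)" "\<kappa> (s' n)" "K + C + 4 * \<delta>"] N[of m] N'[of n] that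
          pull[of "s m" "s' n"] by auto
      then show "\<exists>N. \<forall>m\<ge>N. \<forall>n\<ge>N. K \<le> gromov_prod (s m) (s' n) b" by blast
    qed
    obtain e1 where e1: "e1 = 1 \<or> e1 = -1" "ends e1 u" using end_exists[OF conv(1)] by blast
    obtain e2 where e2: "e2 = 1 \<or> e2 = -1" "ends e2 v" using end_exists[OF conv(2)] by blast
    obtain e3 where e3: "e3 = 1 \<or> e3 = -1" "ends e3 w" using end_exists[OF conv(3)] by blast
    \<comment> \<open>Three sequences and two signs: two of them share an end.\<close>
    have "e1 = e2 \<or> e2 = e3 \<or> e1 = e3" using e1(1) e2(1) e3(1) by auto
    then show False using same_end e1 e2 e3 diff by blast
  qed
  then show ?thesis using that by blast
qed

text \<open>One step along the axis moves by at most 9 \<delta>, so a first point beyond 49 \<delta>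
  is still within 58 \<delta> of the orbit, and \<open>entropy_close\<close> applies to a
  transversal translate obtained there.\<close>

lemma small_entropy_parallel:
  assumes small: "\<not> entropy G act x > ereal (1 / (750 * \<delta>))"
    and h: "h \<in> carrier G" and close: "dist y (act h y) \<le> 49 * \<delta>"
  shows "\<exists>k. dist (act h (ax (int j))) (ax k) \<le> 49 * \<delta>"
proof (induction j)
  case 0
  show ?case using close by (intro exI[of _ 0]) (simp add: dist_commute)
next
  case (Suc j)
  then obtain k where k: "dist (act h (ax (int j))) (ax k) \<le> 49 * \<delta>" by blast
  define h' where "h' = h \<otimes> \<gamma> [^] int (Suc j)"
  have h': "h' \<in> carrier G" "act h' y = act h (ax (int (Suc j)))"
    using h gamma by (simp_all add: h'_def act_mult)
  show ?case
  proof (rule ccontr)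
    assume "\<not> ?case"
    then have "26 * \<delta> \<le> dist (act h' y) (ax i)" for i
      using delta_pos h' by (smt (verit))
    then obtain g e where ge: "transversal G \<delta> act D \<gamma> y l g e" "\<And>i. dist y (act g y) \<le> dist (act h' y) (ax i)"
      using transversal_exists[OF h'(1)] by blast
    have "dist (act h (ax (int (Suc j)))) (act h (ax (int j))) \<le> l + 8 * \<delta>"
      using h ax_dist(2)[of "int (Suc j)" "int j"] by simp
    then have "dist (act h' y) (ax k) \<le> 58 * \<delta>"
      using k l_le dist_triangle[of "act h' y" "ax k" "act h (ax (int j))"] h' by simp
    then have "dist y (act g y) \<le> 58 * \<delta>" using ge(2)[of k] by simp
    then show False using transversal.entropy_close[OF ge(1)] small by blast
  qed
qed

lemma entropy_of_short_axis:
  assumes ne: "non_elementary TYPE('a)"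
    and N: "real N * l \<le> \<delta>" "1 / (750 * \<delta>) < ln N / (4 * D + 83 * \<delta>)"
  shows "entropy G act x > ereal (1 / (750 * \<delta>))"
proof (rule ccontr)
  assume small: "\<not> ?thesis"
  \<comment> \<open>Moving to an orbit point of the group costs less than
    \<open>D + \<delta>\<close> and leaves 26 \<delta>. Then \<open>t\<close> is at most
    \<open>R + D + \<delta>\<close>, so \<open>2 * t + 27 * \<delta>\<close> is at most
    \<open>4 * D + 83 * \<delta>\<close>.\<close>
  define R where "R = D + 27 * \<delta>"
  have R0: "0 \<le> R" using D_nonneg delta_pos by (simp add: R_def)
  obtain z0 where z0: "\<And>k. R \<le> dist z0 (ax k)" using far_point[OF ne] by blast
  obtain k0 where k0: "\<And>k. dist z0 (ax k0) \<le> dist z0 (ax k)" using nearest_exists by blast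
  \<comment> \<open>Walking from a nearest orbit point towards \<open>z0\<close> yields a point at
    distance exactly \<open>R\<close> from the orbit of \<gamma>.\<close>
  have "R \<le> dist (ax k0) z0" using z0[of k0] by (simp add: dist_commute)
  from point_between[OF R0 this] obtain z
    where z: "dist (ax k0) z = R" "dist z z0 = dist (ax k0) z0 - R" by blast
  have zR: "R \<le> dist z (ax k)" for k
    using z(2) k0[of k] dist_triangle[of z0 "ax k" z] by (simp add: dist_commute)
  obtain h where h: "h \<in> carrier G" "dist z (act h y) < D + \<delta>"
    using orbit_near[OF delta_pos] by blast
  have "26 * \<delta> \<le> dist (act h y) (ax k)" for k
    using zR[of k] h(2) dist_triangle[of z "ax k" "act h y"] by (simp add: R_def)
  then obtain g e where ge: "transversal G \<delta> act D \<gamma> y l g e" "\<And>k. dist y (act g y) \<le> dist (act h y) (ax k)"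
    using transversal_exists[OF h(1)] by blast
  interpret transversal G \<delta> T act D \<gamma> y l g e by (rule ge(1))
  have t: "t \<le> 2 * D + 28 * \<delta>"
    using ge(2)[of k0] z(1) h(2) dist_triangle[of "act h y" "ax k0" z] by (simp add: R_def dist_commute)
  \<comment> \<open>Otherwise the conjugate of a power of \<gamma> by \<open>inv g\<close> moves
    \<open>y\<close> by at most 49 \<delta>; small entropy then makes it send the half-axis near the
    axis, against \<open>not_parallel\<close>.\<close>
  have sep: "49 * \<delta> < dist (act g y) (act (\<gamma> [^] m) (act g y))" if "m \<noteq> 0" for m :: int
  proof (rule ccontr)
    assume "\<not> ?thesis"
    moreover have "dist y (act (inv g \<otimes> \<gamma> [^] m \<otimes> g) y) = dist (act g y) (act (\<gamma> [^] m) (act g y))"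
      using g gamma by (simp add: act_mult act_dist_swap)
    ultimately have "dist y (act (inv g \<otimes> \<gamma> [^] m \<otimes> g) y) \<le> 49 * \<delta>" by simp
    then have "\<exists>k. dist (act (inv g \<otimes> \<gamma> [^] m \<otimes> g) (ax (int j))) (ax k) \<le> 49 * \<delta>" for j
      using g gamma by (intro small_entropy_parallel[OF small]) auto
    then show False using not_parallel[OF that] by blast
  qed
  have "0 < 2 * t + 27 * \<delta>" using delta_pos by (simp add: add_nonneg_pos)
  have "0 < 4 * D + 83 * \<delta>" using D_nonneg delta_pos by simp
  have "0 < 1 / (750 * \<delta>)" using delta_pos by simp
  from less_trans[OF this N(2)] have "0 < ln N" using \<open>0 < 4 * D + 83 * \<delta>\<close>
    by (simp only: zero_less_divide_iff) auto
  then have "ln N / (4 * D + 83 * \<delta>) \<le> ln N / (2 * t + 27 * \<delta>)"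
    using t \<open>0 < 2 * t + 27 * \<delta>\<close> \<open>0 < 4 * D + 83 * \<delta>\<close> by (intro divide_left_mono mult_pos_pos) auto
  from less_le_trans[OF N(2) this] have "entropy G act x > ereal (1 / (750 * \<delta>))"
    using delta_pos by (intro entropy_many_letters[OF N(1) sep]) auto
  then show False using small by blast
qed

end

theorem theorem5p3:
  fixes G :: "('g, 'b) monoid_scheme" and act :: "'g \<Rightarrow> 'a::metric_space \<Rightarrow> 'a"
    and \<delta> D :: real and x0 :: 'a
  assumes "\<delta> > 0"
    and "hyperbolic_space \<delta> TYPE('a)"
    and "non_elementary TYPE('a)"
    and "isometric_action G act"
    and "proper_action G act"
    and "quot_diam_le G act D"
  defines "M0 \<equiv> max (20 * (D / \<delta> + 2)) 720"
  shows "entropy G act x0 > ereal (1 / (750 * \<delta>)) \<or>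
         (\<forall>\<gamma>\<in>carrier G. \<gamma> \<noteq> \<one>\<^bsub>G\<^esub> \<and> (\<forall>n::nat. n > 0 \<longrightarrow> \<gamma> [^]\<^bsub>G\<^esub> n \<noteq> \<one>\<^bsub>G\<^esub>) \<longrightarrow>
            transl_len G act x0 \<gamma> > 3 powr (-34) * \<delta> * M0 * exp (-(4/29) * M0))"
proof (rule ccontr)
  assume contra: "\<not> ?thesis"
  interpret group G using assms(4) by (simp add: isometric_action_def)
  interpret hyp_action G \<delta> "TYPE('a)" act D
    by (intro hyp_action.intro gromov_hyperbolic.intro hyp_action_axioms.intro group_axioms assms)
  from contra have small: "\<not> entropy G act x0 > ereal (1 / (750 * \<delta>))" by blast
  from contra obtain \<gamma> where \<gamma>: "\<gamma> \<in> carrier G" "\<forall>n::nat. n > 0 \<longrightarrow> \<gamma> [^]\<^bsub>G\<^esub> n \<noteq> \<one>\<^bsub>G\<^esub>"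
    and "\<not> transl_len G act x0 \<gamma> > 3 powr (-34) * \<delta> * M0 * exp (-(4/29) * M0)"
    by blast
  then have short: "transl_len G act x0 \<gamma> \<le> 3 powr (-34) * \<delta> * M0 * exp (-(4/29) * M0)"
    by (simp only: not_less)
  obtain l y where l: "l > 0" "\<And>k::nat. real k * l \<le> dist y (act (\<gamma> [^]\<^bsub>G\<^esub> k) y)"
    "\<And>k::nat. dist y (act (\<gamma> [^]\<^bsub>G\<^esub> k) y) \<le> real k * l + 8 * \<delta>"
    by (rule axis_exists[OF \<gamma>]) (rule that; assumption)
  have "transl_len G act x0 \<gamma> = l" by (rule transl_len_eq[OF \<gamma>(1) l(2,3)])
  with short have short_l: "l \<le> 3 powr (-34) * \<delta> * M0 * exp (-(4/29) * M0)" by (simp only:)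
  have M0: "720 \<le> M0" "20 * (D / \<delta> + 2) \<le> M0" by (simp_all add: M0_def)
  obtain N :: nat where N: "real N * l \<le> \<delta>" "1 / (750 * \<delta>) < ln N / (4 * D + 83 * \<delta>)" "l \<le> \<delta>"
    by (rule orbit_count_exponent[OF assms(1) D_nonneg l(1) M0 short_l])
  \<comment> \<open>Only a short \<open>l\<close> gives access to the estimates in
    \<open>axis\<close>, whose assumption \<open>l \<le> \<delta>\<close> is
    \<open>N(3)\<close>.\<close>
  interpret axis G \<delta> "TYPE('a)" act D \<gamma> y l
    by (intro axis.intro hyp_action_axioms axis_axioms.intro \<gamma>(1) l N(3))
  show False using entropy_of_short_axis[OF assms(3) N(1,2)] small by blast
qed

end
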